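(* Let $p,q$ be positive integers, let $n=pq$, and let $1\le r\le n$, $1\le s\le n$. Let $R$ be an $r\times s$ $(p,q)$-Sudoku rectangle on the symbol set $\mathcal{C}=\{1,2,\dots,n\}$. Let $P$ be the partial $n\times n$ $(p,q)$-Sudoku square with $R$ in the top left-hand corner (first $r$ rows, first $s$ columns) and the remaining cells empty. Then $P$ can be completed to an $n\times n$ $(p,q)$-Sudoku square on $\mathcal{C}$ if and only if $P$ satisfies Hall's Condition for partial Sudoku squares.
   Context: A latin square of order $n$ is an $n\times n$ array with entries from $\{1,\dots,n\}$ in which each symbol occurs exactly once in each row and each column. An $r\times s$ latin rectangle on the symbols $\{1,\dots,n\}$ is an $r\times s$ array in which every cell is filled with a symbol from $\{1,\dots,n\}$ and no symbol occurs more than once in any row or column. For $n=pq$, the big cells of the $n\times n$ grid are the $p\times q$ rectangles $\{(xp+i,\,yq+j): 1\le i\le p,\ 1\le j\le q\}$ for $0\le x\le q-1$, $0\le y\le p-1$; the $1\times1$ cells are called (small) cells. A $(p,q)$-Sudoku square is a latin square of order $n=pq$ in which each big cell contains each of the symbols $1,\dots,n$ exactly once. An $r\times s$ $(p,q)$-Sudoku rectangle on $n=pq$ symbols ($r,s\le n$) is an $r\times s$ latin rectangle on $\{1,\dots,n\}$, regarded as occupying the first $r$ rows and first $s$ columns of the $n\times n$ grid, such that no symbol occurs more than once within the part of any big cell that lies in the rectangle. A partial $(p,q)$-Sudoku square is an $n\times n$ array in which some cells are filled from $\mathcal{C}$ and some are empty, with no symbol occurring more than once in any row, column or big cell; completing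 it means filling the empty cells so as to obtain a $(p,q)$-Sudoku square. Hall's Condition for partial Sudoku squares: let $P$ be a partial $(p,q)$-Sudoku square on $\mathcal{C}$. For each cell $v$ define the list $L_S(v)$ as follows: if $v$ is filled, $L_S(v)$ consists of just the symbol in $v$; if $v$ is empty, $L_S(v)$ is the set of symbols in $\mathcal{C}$ that are not used in any cell in the same row as $v$, nor in any cell in the same column as $v$, nor in any cell of the big cell containing $v$. A set of cells is independent if no two of its cells lie in the same row, or in the same column, or in the same big cell. For a set $Q$ of cells and a symbol $\sigma$, let $\alpha(L_S,\sigma,Q)$ be the maximum size of an independent set of cells of $Q$ all of which contain $\sigma$ in their lists. Hall's Inequality for $Q$ is $$\sum_{\sigma\in\mathcal{C}}\alpha(L_S,\sigma,Q)\ \ge\ |Q|.$$ $P$ satisfies Hall's Condition for partial Sudoku squares if Hall's Inequality for $Q$ holds for every subset $Q$ of the set of all $n^2$ cells of $P$. *)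

theory Defs
  imports Main
begin

text \<open>A cell is a pair (row, column), with rows and columns numbered from 1. A fully filled array
  is a function on cells that is only inspected on the cells of the array; in a partial array,
  \<open>None\<close> marks an empty cell.\<close>

type_synonym cell = "nat \<times> nat"

definition cells :: "nat \<Rightarrow> cell set" where
  "cells n = {1..n} \<times> {1..n}"

text \<open>Big cells have \<open>p\<close> rows and \<open>q\<close> columns, so there are \<open>q\<close> bands of rows and \<open>p\<close> stacks
  of columns.\<close>

definition big_cell :: "nat \<Rightarrow> nat \<Rightarrow> nat \<Rightarrow> nat \<Rightarrow> cell set" where
  "big_cell p q x y = {(x * p + i, y * q + j) | i j. i \<in> {1..p} \<and> j \<in> {1..q}}"

definition big_cells :: "nat \<Rightarrow> nat \<Rightarrow> cell set set" where
  "big_cells p q = {big_cell p q x y | x y. x < q \<and> y < p}"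

definition latin_square :: "nat \<Rightarrow> (cell \<Rightarrow> nat) \<Rightarrow> bool" where
  "latin_square n L \<longleftrightarrow>
     (\<forall>c\<in>cells n. L c \<in> {1..n}) \<and>
     (\<forall>i\<in>{1..n}. \<forall>\<sigma>\<in>{1..n}. \<exists>!j. j \<in> {1..n} \<and> L (i, j) = \<sigma>) \<and>
     (\<forall>j\<in>{1..n}. \<forall>\<sigma>\<in>{1..n}. \<exists>!i. i \<in> {1..n} \<and> L (i, j) = \<sigma>)"

definition sudoku_square :: "nat \<Rightarrow> nat \<Rightarrow> (cell \<Rightarrow> nat) \<Rightarrow> bool" where
  "sudoku_square p q L \<longleftrightarrow>
     latin_square (p * q) L \<and>
     (\<forall>B\<in>big_cells p q. \<forall>\<sigma>\<in>{1..p * q}. \<exists>!c. c \<in> B \<and> L c = \<sigma>)"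

definition latin_rectangle :: "nat \<Rightarrow> nat \<Rightarrow> nat \<Rightarrow> (cell \<Rightarrow> nat) \<Rightarrow> bool" where
  "latin_rectangle n r s R \<longleftrightarrow>
     (\<forall>c\<in>{1..r} \<times> {1..s}. R c \<in> {1..n}) \<and>
     (\<forall>i\<in>{1..r}. inj_on (\<lambda>j. R (i, j)) {1..s}) \<and>
     (\<forall>j\<in>{1..s}. inj_on (\<lambda>i. R (i, j)) {1..r})"

definition sudoku_rectangle :: "nat \<Rightarrow> nat \<Rightarrow> nat \<Rightarrow> nat \<Rightarrow> (cell \<Rightarrow> nat) \<Rightarrow> bool" where
  "sudoku_rectangle p q r s R \<longleftrightarrow>
     latin_rectangle (p * q) r s R \<and>
     (\<forall>B\<in>big_cells p q. inj_on R (B \<inter> {1..r} \<times> {1..s}))"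

definition same_big_cell :: "nat \<Rightarrow> nat \<Rightarrow> cell \<Rightarrow> cell \<Rightarrow> bool" where
  "same_big_cell p q v w \<longleftrightarrow> (\<exists>B\<in>big_cells p q. v \<in> B \<and> w \<in> B)"

definition same_line_or_big_cell :: "nat \<Rightarrow> nat \<Rightarrow> cell \<Rightarrow> cell \<Rightarrow> bool" where
  "same_line_or_big_cell p q v w \<longleftrightarrow>
     fst v = fst w \<or> snd v = snd w \<or> same_big_cell p q v w"

definition partial_sudoku_square :: "nat \<Rightarrow> nat \<Rightarrow> (cell \<Rightarrow> nat option) \<Rightarrow> bool" where
  "partial_sudoku_square p q P \<longleftrightarrow>
     (\<forall>v\<in>cells (p * q). \<forall>\<sigma>. P v = Some \<sigma> \<longrightarrow> \<sigma> \<in> {1..p * q}) \<and>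
     (\<forall>v\<in>cells (p * q). \<forall>w\<in>cells (p * q).
        v \<noteq> w \<and> same_line_or_big_cell p q v w \<and> P v \<noteq> None \<longrightarrow> P v \<noteq> P w)"

definition can_be_completed :: "nat \<Rightarrow> nat \<Rightarrow> (cell \<Rightarrow> nat option) \<Rightarrow> bool" where
  "can_be_completed p q P \<longleftrightarrow>
     (\<exists>L. sudoku_square p q L \<and>
        (\<forall>v\<in>cells (p * q). \<forall>\<sigma>. P v = Some \<sigma> \<longrightarrow> L v = \<sigma>))"

definition top_left :: "nat \<Rightarrow> nat \<Rightarrow> (cell \<Rightarrow> nat) \<Rightarrow> cell \<Rightarrow> nat option" where
  "top_left r s R v = (if v \<in> {1..r} \<times> {1..s} then Some (R v) else None)"

definition hall_list :: "nat \<Rightarrow> nat \<Rightarrow> (cell \<Rightarrow> nat option) \<Rightarrow> cell \<Rightarrow> nat set" where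
  "hall_list p q P v =
     (case P v of
        Some \<sigma> \<Rightarrow> {\<sigma>}
      | None \<Rightarrow> {\<sigma> \<in> {1..p * q}.
          \<not> (\<exists>w\<in>cells (p * q). same_line_or_big_cell p q v w \<and> P w = Some \<sigma>)})"

definition independent_cells :: "nat \<Rightarrow> nat \<Rightarrow> cell set \<Rightarrow> bool" where
  "independent_cells p q I \<longleftrightarrow> pairwise (\<lambda>v w. \<not> same_line_or_big_cell p q v w) I"

text \<open>For finite \<open>Q\<close> the maximum below is over a finite set containing 0 (from \<open>I = {}\<close>); it is
  used only for sets \<open>Q\<close> of cells of the square.\<close>

definition hall_alpha :: "nat \<Rightarrow> nat \<Rightarrow> (cell \<Rightarrow> nat set) \<Rightarrow> nat \<Rightarrow> cell set \<Rightarrow> nat" where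
  "hall_alpha p q LS \<sigma> Q =
     Max {card I | I. I \<subseteq> Q \<and> independent_cells p q I \<and> (\<forall>v\<in>I. \<sigma> \<in> LS v)}"

definition hall_inequality :: "nat \<Rightarrow> nat \<Rightarrow> (cell \<Rightarrow> nat option) \<Rightarrow> cell set \<Rightarrow> bool" where
  "hall_inequality p q P Q \<longleftrightarrow>
     (\<Sum>\<sigma>\<in>{1..p * q}. hall_alpha p q (hall_list p q P) \<sigma> Q) \<ge> card Q"

definition hall_condition :: "nat \<Rightarrow> nat \<Rightarrow> (cell \<Rightarrow> nat option) \<Rightarrow> bool" where
  "hall_condition p q P \<longleftrightarrow> (\<forall>Q. Q \<subseteq> cells (p * q) \<longrightarrow> hall_inequality p q P Q)"

lemma partial_sudoku_square_top_left:
  assumes "sudoku_rectangle p q r s R"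
  shows "partial_sudoku_square p q (top_left r s R)"
  unfolding partial_sudoku_square_def
proof (intro conjI ballI allI impI)
  fix v \<sigma> assume "top_left r s R v = Some \<sigma>"
  then show "\<sigma> \<in> {1..p * q}"
    using assms by (auto simp: top_left_def sudoku_rectangle_def latin_rectangle_def split: if_splits)
next
  fix v w
  assume vw: "v \<noteq> w \<and> same_line_or_big_cell p q v w \<and> top_left r s R v \<noteq> None"
  show "top_left r s R v \<noteq> top_left r s R w"
  proof
    assume "top_left r s R v = top_left r s R w"
    with vw have mem: "v \<in> {1..r} \<times> {1..s}" "w \<in> {1..r} \<times> {1..s}" and eq: "R v = R w"
      by (auto simp: top_left_def split: if_splits)
    have lr: "latin_rectangle (p * q) r s R"
      and big: "\<And>B. B \<in> big_cells p q \<Longrightarrow> inj_on R (B \<inter> {1..r} \<times> {1..s})"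
      using assms by (auto simp: sudoku_rectangle_def)
    obtain a b c d where vd: "v = (a, b)" and wd: "w = (c, d)" by (metis surj_pair)
    from vw consider "a = c" | "b = d" | "same_big_cell p q v w"
      by (auto simp: same_line_or_big_cell_def vd wd)
    then show False
    proof cases
      case 1
      then have "inj_on (\<lambda>j. R (a, j)) {1..s}" using lr mem vd by (auto simp: latin_rectangle_def)
      then have "b = d" using 1 mem eq vd wd by (auto dest!: inj_onD)
      then show False using 1 vw vd wd by simp
    next
      case 2
      then have "inj_on (\<lambda>i. R (i, b)) {1..r}" using lr mem vd by (auto simp: latin_rectangle_def)
      then have "a = c" using 2 mem eq vd wd by (auto dest!: inj_onD)
      then show False using 2 vw vd wd by simp
    next
      case 3
      then obtain B where "B \<in> big_cells p q" "v \<in> B" "w \<in> B" by (auto simp: same_big_cell_def)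
      with big mem eq have "v = w" by (meson IntI inj_onD)
      then show False using vw by simp
    qed
  qed
qed

end

theory Submission
  imports Defs "HOL-Combinatorics.Transposition"
begin

text \<open>If the square is completed by \<open>L\<close>, the cells of \<open>Q\<close> carrying \<open>\<sigma>\<close> in \<open>L\<close> form an
  independent set, and counting \<open>Q\<close> by symbols gives Hall's Inequality.

  For the converse, let \<open>x\<close> and \<open>y\<close> be the last band and the last stack that the rectangle reaches.
  Only the big cells of band \<open>x\<close> and stack \<open>y\<close>, up to and including their common corner big
  cell, can be partly filled; call these the border. The proof has three steps.

  A provisional filling: apply Hall's Inequality to \<open>Q\<close> made of some empty cells
  \<open>W\<close> of one border big cell and all of the other border big cells. Each symbol contributes at most
  one cell per border big cell, so at least \<open>|W|\<close> symbols attain that maximum, that is, admit an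
  independent system \<open>I\<close> with one cell in every border big cell, one of them in \<open>W\<close>
  (\<open>many_symbols\<close>). This is exactly the hypothesis of the marriage theorem for filling the empty cells
  \<open>v\<close> of a border big cell bijectively with symbols that have such a system through \<open>v\<close>. The
  filling \<open>T\<close> so obtained may repeat a symbol in a column to the right of the rectangle or in
  a row below it, but nowhere else.

  Straightening: the systems \<open>I\<close> show that \<open>T\<close> uses each symbol at most as often in
  the new columns as there are new columns (\<open>few_right_and_bottom\<close>). By Koenig's theorem on
  edge colourings of bipartite graphs, in the form \<open>straighten_array\<close>, the entries in the new columns can
  be permuted inside their rows so that no column repeats a symbol. This keeps every entry in its
  row and in its big cell. The new rows are then straightened in the same way; permuting inside columns
  does no harm to the columns. The result is a Sudoku rectangle that consists of whole big cells.

  A rectangle of whole big cells can always be extended by a further stack (\<open>add_stack\<close>): each band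
  meets Hall's condition by a regularity count, and since every symbol then occurs at most once per
  band in the new stack, straightening applies. Repeating this, and then doing
  the same for bands, completes the square.\<close>

section \<open>Hall's marriage theorem\<close>

text \<open>If some proper nonempty subfamily \<open>K\<close> is tight, match it inside its union \<open>U\<close> and the rest
  outside \<open>U\<close>, where Hall's condition persists because \<open>K\<close> uses up exactly \<open>U\<close>. If none is
  tight, there is a spare element everywhere, so any choice for one index can be made and its value
  withdrawn from the others.\<close>

theorem hall_marriage:
  fixes A :: "'i \<Rightarrow> 'a set"
  assumes "finite J" and "\<And>i. i \<in> J \<Longrightarrow> finite (A i)"
    and "\<And>K. K \<subseteq> J \<Longrightarrow> card K \<le> card (\<Union>(A ` K))"
  shows "\<exists>f. inj_on f J \<and> (\<forall>i\<in>J. f i \<in> A i)"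
  using assms
proof (induction "card J" arbitrary: J A rule: less_induct)
  case less
  note fin = less.prems(1) and finA = less.prems(2) and hall = less.prems(3)
  have combine: "\<exists>f. inj_on f J \<and> (\<forall>i\<in>J. f i \<in> A i)"
    if K: "K \<subseteq> J" and g: "inj_on g K" "\<forall>i\<in>K. g i \<in> A i \<inter> U"
      and h: "inj_on h (J - K)" "\<forall>i\<in>J - K. h i \<in> A i - U" for K g h U
  proof (intro exI conjI)
    let ?f = "\<lambda>i. if i \<in> K then g i else h i"
    show "inj_on ?f J"
    proof (rule inj_onI)
      fix i j assume "i \<in> J" "j \<in> J" "?f i = ?f j"
      moreover have "i' \<in> K \<Longrightarrow> g i' \<in> U" "i' \<in> J - K \<Longrightarrow> h i' \<notin> U" for i'
        using g h by auto
      ultimately show "i = j" using inj_onD[OF g(1)] inj_onD[OF h(1)]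
        by (metis DiffI)
    qed
    show "\<forall>i\<in>J. ?f i \<in> A i" using g h by auto
  qed
  show ?case
  proof (cases "\<exists>K. K \<noteq> {} \<and> K \<subset> J \<and> card K = card (\<Union>(A ` K))")
    case True
    then obtain K where K: "K \<noteq> {}" "K \<subset> J" "card K = card (\<Union>(A ` K))" by blast
    let ?U = "\<Union>(A ` K)"
    have finK: "finite K" using K(2) fin finite_subset by blast
    have finU: "finite ?U" using K(2) finK finA by auto
    have "\<exists>g. inj_on g K \<and> (\<forall>i\<in>K. g i \<in> A i)"
      using K(2) by (intro less.hyps psubset_card_mono fin finA hall finK) auto
    then obtain g where g: "inj_on g K" "\<forall>i\<in>K. g i \<in> A i" by blast
    have "\<exists>h. inj_on h (J - K) \<and> (\<forall>i\<in>J - K. h i \<in> A i - ?U)"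
    proof (intro less.hyps)
      show "card (J - K) < card J" using K fin by (intro psubset_card_mono) auto
      show "card L \<le> card (\<Union>i\<in>L. A i - ?U)" if L: "L \<subseteq> J - K" for L
      proof -
        have finL: "finite L" using L fin finite_subset by blast
        have finB: "finite (\<Union>i\<in>L. A i - ?U)" using L finL finA by auto
        have "card L + card K = card (L \<union> K)"
          using L finL finK by (subst card_Un_disjoint) auto
        also have "\<dots> \<le> card (\<Union>(A ` (L \<union> K)))" using L K(2) by (intro hall) auto
        also have "\<Union>(A ` (L \<union> K)) = (\<Union>i\<in>L. A i - ?U) \<union> ?U" by auto
        also have "card \<dots> = card (\<Union>i\<in>L. A i - ?U) + card ?U"
          by (rule card_Un_disjoint) (use finB finU in auto)
        finally show ?thesis using K(3) by linarith
      qed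
    qed (use fin finA in auto)
    then obtain h where h: "inj_on h (J - K)" "\<forall>i\<in>J - K. h i \<in> A i - ?U" by blast
    show ?thesis using K(2) g h by (intro combine[of K g ?U h]) auto
  next
    case False
    show ?thesis
    proof (cases "J = {}")
      case True then show ?thesis by simp
    next
      case False
      then obtain i where i: "i \<in> J" by blast
      have "card {i} \<le> card (\<Union>(A ` {i}))" by (rule hall) (use i in auto)
      then have "A i \<noteq> {}" by auto
      then obtain a where a: "a \<in> A i" by blast
      have "\<exists>h. inj_on h (J - {i}) \<and> (\<forall>j\<in>J - {i}. h j \<in> A j - {a})"
      proof (intro less.hyps)
        show "card (J - {i}) < card J" by (rule card_Diff1_less[OF fin i])
        show "card L \<le> card (\<Union>j\<in>L. A j - {a})" if L: "L \<subseteq> J - {i}" for L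
        proof (cases "L = {}")
          case False
          have L': "L \<subset> J" using L i by auto
          then have "card L \<noteq> card (\<Union>(A ` L))" 
            using \<open>\<not> (\<exists>K. K \<noteq> {} \<and> K \<subset> J \<and> card K = card (\<Union>(A ` K)))\<close> False by blast
          moreover have "card L \<le> card (\<Union>(A ` L))" by (rule hall) (use L' in auto)
          moreover have "(\<Union>j\<in>L. A j - {a}) = \<Union>(A ` L) - {a}" by auto
          moreover have "card (\<Union>(A ` L) - {a}) \<ge> card (\<Union>(A ` L)) - 1"
            by (simp add: card_Diff_singleton_if)
          ultimately show ?thesis by simp
        qed simp
      qed (use fin finA in auto)
      then obtain h where h: "inj_on h (J - {i})" "\<forall>j\<in>J - {i}. h j \<in> A j - {a}" by blast
      show ?thesis using i a h by (intro combine[of "{i}" "\<lambda>_. a" "{a}" h]) auto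
    qed
  qed
qed

section \<open>Straightening the columns of an array\<close>

lemma card_eq_sum_card_fibres:
  assumes "finite D" "finite S" "\<And>v. v \<in> D \<Longrightarrow> f v \<in> S"
  shows "card D = (\<Sum>\<sigma>\<in>S. card {v \<in> D. f v = \<sigma>})"
proof -
  have "card (\<Union>\<sigma>\<in>S. {v \<in> D. f v = \<sigma>}) = (\<Sum>\<sigma>\<in>S. card {v \<in> D. f v = \<sigma>})"
    using assms by (intro card_UN_disjoint) auto
  moreover have "(\<Union>\<sigma>\<in>S. {v \<in> D. f v = \<sigma>}) = D" using assms by auto
  ultimately show ?thesis by simp
qed

text \<open>Koenig's theorem for regular bipartite multigraphs: rows \<open>A\<close> and symbols \<open>S\<close> are the vertices,
  the entries of the array \<open>T\<close> are the edges, and the column to which an entry is moved is its colour.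
  Regularity gives a perfect matching of rows to symbols; the matched entries are moved to column
  \<open>c0\<close>, and the other columns are regular again with degree one less.\<close>

lemma straighten_regular_array:
  fixes T :: "'r \<times> 'c \<Rightarrow> 's"
  assumes "finite C" and "finite A" and "finite S"
    and "\<And>v. v \<in> A \<times> C \<Longrightarrow> T v \<in> S"
    and "\<And>\<sigma>. \<sigma> \<in> S \<Longrightarrow> card {v \<in> A \<times> C. T v = \<sigma>} = card C"
  shows "\<exists>\<pi>. (\<forall>a\<in>A. bij_betw (\<pi> a) C C) \<and> (\<forall>c\<in>C. inj_on (\<lambda>a. T (a, \<pi> a c)) A)"
  using assms
proof (induction C arbitrary: T rule: finite_induct)
  case empty
  then show ?case by (auto simp: bij_betw_def)
next
  case (insert c0 C)
  let ?C = "insert c0 C"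
  have fin: "finite ?C" using insert by simp
  have k: "card ?C > 0" using fin by (simp add: card_gt_0_iff)
  have rng: "T v \<in> S" if "v \<in> A \<times> ?C" for v using insert.prems that by blast
  have cnt: "card {v \<in> A \<times> ?C. T v = \<sigma>} = card ?C" if "\<sigma> \<in> S" for \<sigma>
    using insert.prems that by blast
  have "\<exists>h. inj_on h A \<and> (\<forall>a\<in>A. h a \<in> (\<lambda>c. T (a, c)) ` ?C)"
  proof (rule hall_marriage)
    fix K assume K: "K \<subseteq> A"
    let ?N = "\<Union>a\<in>K. (\<lambda>c. T (a, c)) ` ?C"
    have finK: "finite K" using K insert.prems finite_subset by blast
    have N: "?N \<subseteq> S" using K rng by auto
    have finN: "finite ?N" using N insert.prems finite_subset by blast
    have "card K * card ?C = card (K \<times> ?C)" by (simp add: card_cartesian_product)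
    also have "\<dots> = (\<Sum>\<sigma>\<in>?N. card {v \<in> K \<times> ?C. T v = \<sigma>})"
      by (rule card_eq_sum_card_fibres) (use finK fin finN in auto)
    also have "\<dots> \<le> (\<Sum>\<sigma>\<in>?N. card {v \<in> A \<times> ?C. T v = \<sigma>})"
      using K insert.prems(1) fin by (intro sum_mono card_mono) auto
    also have "\<dots> = (\<Sum>\<sigma>\<in>?N. card ?C)" using N by (intro sum.cong refl cnt) blast
    also have "\<dots> = card ?N * card ?C" by simp
    finally show "card K \<le> card ?N" using k by simp
  qed (use insert.prems fin in auto)
  then obtain h where h: "inj_on h A" "\<forall>a\<in>A. h a \<in> (\<lambda>c. T (a, c)) ` ?C" by blast
  then have "\<forall>a\<in>A. \<exists>c. c \<in> ?C \<and> T (a, c) = h a" by (metis imageE)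
  then obtain m where m: "\<And>a. a \<in> A \<Longrightarrow> m a \<in> ?C" "\<And>a. a \<in> A \<Longrightarrow> T (a, m a) = h a"
    by (metis (no_types))
  have "card A * card ?C = card (A \<times> ?C)" by (simp add: card_cartesian_product)
  also have "\<dots> = (\<Sum>\<sigma>\<in>S. card {v \<in> A \<times> ?C. T v = \<sigma>})"
    by (rule card_eq_sum_card_fibres) (use insert.prems fin rng in auto)
  also have "\<dots> = card S * card ?C" using cnt by simp
  finally have "card A = card S" using k by simp
  moreover have "h ` A \<subseteq> S" using h(2) rng by fastforce
  ultimately have hA: "h ` A = S"
    using h(1) insert.prems by (metis card_image card_subset_eq)
  \<comment> \<open>Swapping the matched entry of each row into column \<open>c0\<close>.\<close>
  define \<tau> where "\<tau> a = transpose c0 (m a)" for a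
  have \<tau>bij: "bij_betw (\<tau> a) ?C ?C" if "a \<in> A" for a
    using m(1)[OF that] unfolding \<tau>_def by (metis bij_betw_transpose_iff insertI1)
  have \<tau>C: "\<tau> a c \<in> ?C" if "a \<in> A" "c \<in> ?C" for a c
    using bij_betwE[OF \<tau>bij[OF that(1)]] that(2) by blast
  have \<tau>\<tau>: "\<tau> a (\<tau> a c) = c" for a c
    by (simp add: \<tau>_def)
  let ?T = "\<lambda>(a, c). T (a, \<tau> a c)"
  have cnt': "card {v \<in> A \<times> C. ?T v = \<sigma>} = card C" if \<sigma>: "\<sigma> \<in> S" for \<sigma>
  proof -
    obtain a where a: "a \<in> A" "h a = \<sigma>" using \<sigma> hA by auto
    have c0C: "{v \<in> A \<times> ?C. ?T v = \<sigma>} = insert (a, c0) {v \<in> A \<times> C. ?T v = \<sigma>}"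
      using a m h(1) by (auto simp: \<tau>_def dest: inj_onD)
    have "bij_betw (\<lambda>(a, c). (a, \<tau> a c)) {v \<in> A \<times> ?C. ?T v = \<sigma>} {v \<in> A \<times> ?C. T v = \<sigma>}"
      by (rule bij_betw_byWitness[where f' = "\<lambda>(a, c). (a, \<tau> a c)"])
         (use \<tau>C in \<open>auto simp: \<tau>\<tau>\<close>)
    from bij_betw_same_card[OF this]
    have "card {v \<in> A \<times> ?C. ?T v = \<sigma>} = card ?C"
      unfolding cnt[OF \<sigma>] .
    then show ?thesis
      unfolding c0C using insert.hyps insert.prems(1) by simp
  qed
  have "\<exists>\<pi>. (\<forall>a\<in>A. bij_betw (\<pi> a) C C) \<and> (\<forall>c\<in>C. inj_on (\<lambda>a. ?T (a, \<pi> a c)) A)"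
  proof (rule insert.IH)
    show "?T v \<in> S" if "v \<in> A \<times> C" for v
      using that \<tau>C rng by auto
  qed (use insert.prems cnt' in auto)
  then obtain \<pi> where \<pi>: "\<And>a. a \<in> A \<Longrightarrow> bij_betw (\<pi> a) C C"
    "\<And>c. c \<in> C \<Longrightarrow> inj_on (\<lambda>a. T (a, \<tau> a (\<pi> a c))) A" by auto
  let ?\<pi> = "\<lambda>a c. \<tau> a (if c = c0 then c0 else \<pi> a c)"
  show ?case
  proof (intro exI conjI ballI)
    fix a assume a: "a \<in> A"
    have "bij_betw (\<lambda>c. if c = c0 then c0 else \<pi> a c) C C"
      using \<pi>(1)[OF a] insert.hyps by (subst bij_betw_cong[where g = "\<pi> a"]) auto
    then have "bij_betw (\<lambda>c. if c = c0 then c0 else \<pi> a c) ?C ?C"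
      using notIn_Un_bij_betw[of c0 C "\<lambda>c. if c = c0 then c0 else \<pi> a c" C] insert.hyps by simp
    from bij_betw_trans[OF this \<tau>bij[OF a]] show "bij_betw (?\<pi> a) ?C ?C"
      by (simp add: o_def)
  next
    fix c assume c: "c \<in> ?C"
    show "inj_on (\<lambda>a. T (a, ?\<pi> a c)) A"
    proof (cases "c = c0")
      case True
      then show ?thesis using h(1) m(2) by (simp add: \<tau>_def inj_on_def)
    next
      case False
      then show ?thesis using \<pi>(2) c by simp
    qed
  qed
qed

text \<open>The case of symbols occurring at most \<open>card C\<close> times reduces to the regular case by appending
  dummy rows \<open>A'\<close> that hold exactly the missing occurrences \<open>Z\<close>. The dummy rows may
  repeat symbols, which is why the regular case is stated without injectivity of the rows. Rows are
  natural numbers so that fresh ones exist.\<close>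

lemma straighten_array:
  fixes T :: "nat \<times> 'c \<Rightarrow> 's"
  assumes "finite C" and "finite A"
    and "\<And>\<sigma>. card {v \<in> A \<times> C. T v = \<sigma>} \<le> card C"
  shows "\<exists>\<pi>. (\<forall>a\<in>A. bij_betw (\<pi> a) C C) \<and> (\<forall>c\<in>C. inj_on (\<lambda>a. T (a, \<pi> a c)) A)"
proof (cases "C = {}")
  case True
  then show ?thesis by (auto simp: bij_betw_def)
next
  case False
  let ?k = "card C" and ?S = "T ` (A \<times> C)"
  have k: "?k > 0" using False assms(1) by (simp add: card_gt_0_iff)
  have finS: "finite ?S" using assms by simp
  let ?o = "\<lambda>\<sigma>. card {v \<in> A \<times> C. T v = \<sigma>}"
  have "card (A \<times> C) = (\<Sum>\<sigma>\<in>?S. ?o \<sigma>)"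
    by (rule card_eq_sum_card_fibres) (use assms finS in auto)
  then have tot: "(\<Sum>\<sigma>\<in>?S. ?o \<sigma>) = card A * ?k" by (simp add: card_cartesian_product)
  define Z where "Z = Sigma ?S (\<lambda>\<sigma>. {..<?k - ?o \<sigma>})"
  have finZ: "finite Z" using finS by (simp add: Z_def)
  have "card Z + card A * ?k = (\<Sum>\<sigma>\<in>?S. (?k - ?o \<sigma>) + ?o \<sigma>)"
    using finS tot by (simp add: Z_def sum.distrib)
  also have "\<dots> = card ?S * ?k" using assms(3) by simp
  finally have Z: "card Z + card A * ?k = card ?S * ?k" .
  then have "card A * ?k \<le> card ?S * ?k" by linarith
  then have AS: "card A \<le> card ?S" using k by simp
  have "\<exists>A'::nat set. finite A' \<and> card A' = card ?S - card A \<and> A \<inter> A' = {}"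
  proof (intro exI conjI)
    let ?A' = "{Suc (Max (insert 0 A))..<Suc (Max (insert 0 A)) + (card ?S - card A)}"
    show "A \<inter> ?A' = {}" using assms(2) by (auto dest: Max_ge[OF assms(2)] simp: Suc_le_eq)
  qed auto
  then obtain A' :: "nat set" where A': "finite A'" "card A' = card ?S - card A" "A \<inter> A' = {}"
    by blast
  have "card (A' \<times> C) = card Z"
    using Z A' by (simp add: card_cartesian_product diff_mult_distrib)
  then obtain \<phi> where \<phi>: "bij_betw \<phi> (A' \<times> C) Z"
    using A' assms(1) finZ by (metis finite_cartesian_product finite_same_card_bij)
  define T' where "T' v = (if v \<in> A \<times> C then T v else fst (\<phi> v))" for v
  have "\<exists>\<pi>. (\<forall>a\<in>A \<union> A'. bij_betw (\<pi> a) C C) \<and> (\<forall>c\<in>C. inj_on (\<lambda>a. T' (a, \<pi> a c)) (A \<union> A'))"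
  proof (rule straighten_regular_array[where S = ?S])
    show "T' v \<in> ?S" if "v \<in> (A \<union> A') \<times> C" for v
      using that \<phi> by (force simp: T'_def Z_def dest!: bij_betwE)
    show "card {v \<in> (A \<union> A') \<times> C. T' v = \<sigma>} = ?k" if \<sigma>: "\<sigma> \<in> ?S" for \<sigma>
    proof -
      have split: "{v \<in> (A \<union> A') \<times> C. T' v = \<sigma>} =
          {v \<in> A \<times> C. T v = \<sigma>} \<union> {v \<in> A' \<times> C. fst (\<phi> v) = \<sigma>}"
        using A'(3) by (auto simp: T'_def)
      have im: "\<phi> ` {v \<in> A' \<times> C. fst (\<phi> v) = \<sigma>} = {z \<in> Z. fst z = \<sigma>}"
        using \<phi> by (auto simp: bij_betw_def)
      have "inj_on \<phi> {v \<in> A' \<times> C. fst (\<phi> v) = \<sigma>}"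
        by (rule inj_on_subset[OF bij_betw_imp_inj_on[OF \<phi>]]) auto
      from card_image[OF this]
      have "card {v \<in> A' \<times> C. fst (\<phi> v) = \<sigma>} = card {z \<in> Z. fst z = \<sigma>}"
        unfolding im by (rule sym)
      also have "{z \<in> Z. fst z = \<sigma>} = {\<sigma>} \<times> {..<?k - ?o \<sigma>}" using \<sigma> by (auto simp: Z_def)
      finally have "card {v \<in> A' \<times> C. fst (\<phi> v) = \<sigma>} = ?k - ?o \<sigma>"
        by (simp add: card_cartesian_product_singleton)
      then show ?thesis
        unfolding split using assms A' by (subst card_Un_disjoint) auto
    qed
  qed (use assms A' finS in auto)
  then obtain \<pi> where \<pi>: "\<And>a. a \<in> A \<Longrightarrow> bij_betw (\<pi> a) C C"
    "\<And>c. c \<in> C \<Longrightarrow> inj_on (\<lambda>a. T' (a, \<pi> a c)) (A \<union> A')"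
    by blast
  have "inj_on (\<lambda>a. T (a, \<pi> a c)) A" if "c \<in> C" for c
  proof -
    have "T' (a, \<pi> a c) = T (a, \<pi> a c)" if "a \<in> A" for a
      using \<pi>(1)[OF that] \<open>c \<in> C\<close> that by (auto simp: T'_def dest: bij_betwE)
    then show ?thesis
      using inj_on_subset[OF \<pi>(2)[OF that], of A] by (simp cong: inj_on_cong)
  qed
  then show ?thesis using \<pi>(1) by blast
qed

section \<open>Bands, stacks and partially correct arrays\<close>

definition block :: "nat \<Rightarrow> nat \<Rightarrow> nat" where
  "block m k = (k - 1) div m"

definition box :: "nat \<Rightarrow> nat \<Rightarrow> cell \<Rightarrow> nat \<times> nat" where
  "box p q v = (block p (fst v), block q (snd v))"

lemma block_eq_iff:
  assumes "m \<ge> 1" and "k \<ge> 1"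
  shows "block m k = b \<longleftrightarrow> b * m < k \<and> k \<le> b * m + m"
proof
  assume b: "block m k = b"
  then have "b * m \<le> k - 1" "k - 1 < m + b * m"
    using assms dividend_less_div_times[of m "k - 1"] div_times_less_eq_dividend[of "k - 1" m]
    by (auto simp only: block_def)
  then show "b * m < k \<and> k \<le> b * m + m" using assms by linarith
next
  assume "b * m < k \<and> k \<le> b * m + m"
  then show "block m k = b"
    unfolding block_def by (intro div_nat_eqI) (use assms in \<open>auto simp: mult.commute[of m]\<close>)
qed

lemma block_less_iff:
  assumes "m \<ge> 1" and "k \<ge> 1"
  shows "block m k < b \<longleftrightarrow> k \<le> b * m"
  using assms by (auto simp: block_def less_mult_imp_div_less div_less_iff_less_mult)

lemma block_le_iff:
  assumes "m \<ge> 1" and "k \<ge> 1"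
  shows "block m k \<le> b \<longleftrightarrow> k \<le> Suc b * m"
  using block_less_iff[OF assms, of "Suc b"] by (simp add: less_Suc_eq_le)

lemma block_mono: "k \<le> l \<Longrightarrow> block m k \<le> block m l"
  by (simp add: block_def div_le_mono)

lemma big_cell_eq: "big_cell p q x y = {x * p + 1..x * p + p} \<times> {y * q + 1..y * q + q}"
proof -
  have "{b * m + 1..b * m + m} = {b * m + i | i. i \<in> {1..m}}" for b m :: nat
    using image_add_atLeastAtMost[of "b * m" 1 m] by (simp add: image_def add.commute conj_commute Bex_def)
  then show ?thesis by (auto simp: big_cell_def simp del: atLeastAtMost_iff)
qed

lemma mem_big_cell_iff:
  assumes "p \<ge> 1" "q \<ge> 1"
  shows "v \<in> big_cell p q x y \<longleftrightarrow> fst v \<ge> 1 \<and> snd v \<ge> 1 \<and> box p q v = (x, y)"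
  using assms block_eq_iff[of p "fst v" x] block_eq_iff[of q "snd v" y]
  by (cases v) (auto simp: big_cell_eq box_def)

lemma box_mem_range:
  assumes "p \<ge> 1" "q \<ge> 1" and "v \<in> cells (p * q)"
  shows "box p q v \<in> {..<q} \<times> {..<p}"
  using assms by (auto simp: cells_def box_def block_less_iff mult.commute)

lemma same_big_cell_iff:
  assumes "p \<ge> 1" "q \<ge> 1" and "v \<in> cells (p * q)" "w \<in> cells (p * q)"
  shows "same_big_cell p q v w \<longleftrightarrow> box p q v = box p q w"
proof
  assume "same_big_cell p q v w"
  then show "box p q v = box p q w"
    using assms by (auto simp: same_big_cell_def big_cells_def mem_big_cell_iff)
next
  assume eq: "box p q v = box p q w"
  have b: "box p q v \<in> {..<q} \<times> {..<p}" using assms by (intro box_mem_range)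
  let ?B = "big_cell p q (fst (box p q v)) (snd (box p q v))"
  have "?B \<in> big_cells p q" using b
    unfolding big_cells_def mem_Collect_eq by (intro exI conjI refl) (auto simp: mem_Times_iff)
  moreover have "v \<in> ?B" "w \<in> ?B"
    using assms eq by (auto simp: mem_big_cell_iff cells_def)
  ultimately show "same_big_cell p q v w" by (auto simp: same_big_cell_def)
qed

lemma box_fibre_eq_big_cell:
  assumes "p \<ge> 1" "q \<ge> 1" and "x < q" "y < p"
  shows "{v \<in> cells (p * q). box p q v = (x, y)} = big_cell p q x y"
proof -
  have "v \<in> cells (p * q)" if "fst v \<ge> 1" "snd v \<ge> 1" "box p q v = (x, y)" for v
  proof -
    have "block p (fst v) < q" "block q (snd v) < p" using assms that by (auto simp: box_def)
    then show ?thesis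
      using assms that by (cases v) (auto simp: cells_def block_less_iff mult.commute)
  qed
  then show ?thesis using assms by (auto simp: mem_big_cell_iff cells_def)
qed

lemma card_box_fibre:
  assumes "p \<ge> 1" "q \<ge> 1" and "x < q" "y < p"
  shows "card {v \<in> cells (p * q). box p q v = (x, y)} = p * q"
  using assms by (simp add: box_fibre_eq_big_cell big_cell_eq card_cartesian_product)

text \<open>The intermediate stages of the completion respect all big cells, but repeat symbols in lines
  that have not been straightened yet; \<open>A\<close> and \<open>B\<close> collect the rows and columns that are
  already correct.\<close>

definition proper_array ::
    "nat \<Rightarrow> nat \<Rightarrow> nat \<Rightarrow> nat \<Rightarrow> nat set \<Rightarrow> nat set \<Rightarrow> (cell \<Rightarrow> nat) \<Rightarrow> bool" where
  "proper_array p q N M A B L \<longleftrightarrow>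
     L ` ({1..N} \<times> {1..M}) \<subseteq> {1..p * q} \<and>
     (\<forall>a\<in>A. inj_on (\<lambda>b. L (a, b)) {1..M}) \<and>
     (\<forall>b\<in>B. inj_on (\<lambda>a. L (a, b)) {1..N}) \<and>
     (\<forall>v\<in>{1..N} \<times> {1..M}. \<forall>w\<in>{1..N} \<times> {1..M}. box p q v = box p q w \<and> L v = L w \<longrightarrow> v = w)"

lemma
  assumes "proper_array p q N M A B L"
  shows proper_array_range: "v \<in> {1..N} \<times> {1..M} \<Longrightarrow> L v \<in> {1..p * q}"
    and proper_array_row: "a \<in> A \<Longrightarrow> inj_on (\<lambda>b. L (a, b)) {1..M}"
    and proper_array_col: "b \<in> B \<Longrightarrow> inj_on (\<lambda>a. L (a, b)) {1..N}"
    and proper_array_box: "v \<in> {1..N} \<times> {1..M} \<Longrightarrow> w \<in> {1..N} \<times> {1..M} \<Longrightarrow>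
      box p q v = box p q w \<Longrightarrow> L v = L w \<Longrightarrow> v = w"
  using assms unfolding proper_array_def by blast+

lemma proper_array_transpose:
  assumes L: "proper_array p q N M A B L"
  shows "proper_array q p M N B A (\<lambda>(b, a). L (a, b))"
  unfolding proper_array_def
proof (intro conjI ballI impI)
  show "(\<lambda>(b, a). L (a, b)) ` ({1..M} \<times> {1..N}) \<subseteq> {1..q * p}"
    using proper_array_range[OF L] by (auto simp: mult.commute[of q p] simp del: atLeastAtMost_iff)
  show "v = w" if "v \<in> {1..M} \<times> {1..N}" "w \<in> {1..M} \<times> {1..N}"
    "box q p v = box q p w \<and> (case v of (b, a) \<Rightarrow> L (a, b)) = (case w of (b, a) \<Rightarrow> L (a, b))" for v w
    using proper_array_box[OF L, of "prod.swap v" "prod.swap w"] that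
    by (cases v; cases w) (simp add: box_def)
qed (use proper_array_row[OF L] proper_array_col[OF L] in simp_all)

lemma sudoku_square_if_proper_array:
  assumes p: "p \<ge> 1" and q: "q \<ge> 1"
    and L: "proper_array p q (p * q) (p * q) {1..p * q} {1..p * q} L"
  shows "sudoku_square p q L"
proof -
  let ?n = "p * q"
  have rng: "L v \<in> {1..?n}" if "v \<in> cells ?n" for v
    using that unfolding cells_def by (rule proper_array_range[OF L])
  have ex1: "\<exists>!u. u \<in> U \<and> g u = \<sigma>"
    if g: "inj_on g U" "g ` U \<subseteq> {1..?n}" "card U = ?n" "\<sigma> \<in> {1..?n}" for g :: "'u \<Rightarrow> nat" and U \<sigma>
  proof -
    have "g ` U = {1..?n}" using g by (intro card_subset_eq) (auto simp: card_image)
    with g(4) have "\<sigma> \<in> g ` U" by simp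
    then obtain u where "u \<in> U" "g u = \<sigma>" by blast
    then show ?thesis using g(1) by (auto dest: inj_onD)
  qed
  show ?thesis
    unfolding sudoku_square_def latin_square_def
  proof (intro conjI ballI)
    show "L c \<in> {1..?n}" if "c \<in> cells ?n" for c using rng that .
    show "\<exists>!j. j \<in> {1..?n} \<and> L (i, j) = \<sigma>" if "i \<in> {1..?n}" "\<sigma> \<in> {1..?n}" for i \<sigma>
      using that rng proper_array_row[OF L]
      by (intro ex1) (auto simp: cells_def simp del: atLeastAtMost_iff)
    show "\<exists>!i. i \<in> {1..?n} \<and> L (i, j) = \<sigma>" if "j \<in> {1..?n}" "\<sigma> \<in> {1..?n}" for j \<sigma>
      using that rng proper_array_col[OF L]
      by (intro ex1) (auto simp: cells_def simp del: atLeastAtMost_iff)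
    show "\<exists>!c. c \<in> B \<and> L c = \<sigma>" if B: "B \<in> big_cells p q" and \<sigma>: "\<sigma> \<in> {1..?n}" for B \<sigma>
    proof (rule ex1)
      obtain x y where xy: "x < q" "y < p" "B = big_cell p q x y"
        using B by (auto simp: big_cells_def)
      then have B': "B = {v \<in> cells ?n. box p q v = (x, y)}"
        using box_fibre_eq_big_cell[OF p q] by simp
      show "card B = ?n" unfolding B' by (rule card_box_fibre) (use p q xy in auto)
      show "L ` B \<subseteq> {1..?n}" using rng B' by auto
      show "inj_on L B"
        using proper_array_box[OF L] unfolding B' inj_on_def cells_def by simp
    qed (rule \<sigma>)
  qed
qed

text \<open>The new columns \<open>{s + 1..M}\<close> lie in one stack, so moving entries inside their rows changes neither
  the contents of the rows nor those of the big cells. The last conclusion records that the content of every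
  row is kept; with it, a count of symbols in the bottom rows survives to the transposed use
  of this lemma.\<close>

lemma straighten_columns:
  assumes L: "proper_array p q N M A {1..s} L" and A: "A \<subseteq> {1..N}" and s: "s \<le> M"
    and stack: "\<And>b. b \<in> {s + 1..M} \<Longrightarrow> block q b = y"
    and few: "\<And>\<sigma>. card {v \<in> {1..N} \<times> {s + 1..M}. L v = \<sigma>} \<le> M - s"
  obtains L' where "proper_array p q N M A {1..M} L'"
    and "\<forall>v\<in>{1..N} \<times> {1..s}. L' v = L v"
    and "\<forall>K\<subseteq>{1..N}. \<forall>\<sigma>.
      card {v \<in> K \<times> {1..M}. L' v = \<sigma>} = card {v \<in> K \<times> {1..M}. L v = \<sigma>}"
proof -
  let ?C = "{s + 1..M}"
  have "\<exists>\<pi>. (\<forall>a\<in>{1..N}. bij_betw (\<pi> a) ?C ?C) \<and> (\<forall>c\<in>?C. inj_on (\<lambda>a. L (a, \<pi> a c)) {1..N})"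
    by (rule straighten_array) (use few in auto)
  then obtain \<pi> where \<pi>: "\<And>a. a \<in> {1..N} \<Longrightarrow> bij_betw (\<pi> a) ?C ?C"
    and col: "\<And>c. c \<in> ?C \<Longrightarrow> inj_on (\<lambda>a. L (a, \<pi> a c)) {1..N}" by blast
  define \<rho> where "\<rho> a b = (if b \<in> ?C then \<pi> a b else b)" for a b
  define L' where "L' v = L (fst v, \<rho> (fst v) (snd v))" for v
  have \<rho>C: "\<rho> a b \<in> ?C" if "a \<in> {1..N}" "b \<in> ?C" for a b
    using bij_betwE[OF \<pi>[OF that(1)]] that(2) by (simp add: \<rho>_def)
  have \<rho>: "bij_betw (\<rho> a) {1..M} {1..M}" if a: "a \<in> {1..N}" for a
  proof -
    have "bij_betw (\<rho> a) ?C ?C"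
      using \<pi>[OF a] by (rule bij_betw_cong[THEN iffD1, rotated]) (simp add: \<rho>_def)
    moreover have "bij_betw (\<rho> a) {1..s} {1..s}"
      by (rule bij_betw_cong[THEN iffD1, OF _ bij_betw_id]) (auto simp: \<rho>_def)
    ultimately have "bij_betw (\<rho> a) ({1..s} \<union> ?C) ({1..s} \<union> ?C)"
      by (intro bij_betw_combine) auto
    moreover have "{1..s} \<union> ?C = {1..M}" using s by auto
    ultimately show ?thesis by simp
  qed
  have \<rho>M: "\<rho> a b \<in> {1..M}" if "a \<in> {1..N}" "b \<in> {1..M}" for a b
    using bij_betwE[OF \<rho>[OF that(1)]] that(2) by blast
  have \<rho>inj: "b = b'" if "a \<in> {1..N}" "b \<in> {1..M}" "b' \<in> {1..M}" "\<rho> a b = \<rho> a b'" for a b b'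
    using bij_betw_imp_inj_on[OF \<rho>[OF that(1)]] that by (auto dest: inj_onD)
  have \<rho>block: "block q (\<rho> a b) = block q b" if "a \<in> {1..N}" "b \<in> {1..M}" for a b
    using \<rho>C[OF that(1)] stack by (cases "b \<in> ?C") (auto simp: \<rho>_def)
  have row: "b = b'" if "a \<in> A" "b \<in> {1..M}" "b' \<in> {1..M}" "L (a, b) = L (a, b')" for a b b'
    using inj_onD[OF proper_array_row[OF L that(1)] that(4,2,3)] .
  show thesis
  proof
    show "proper_array p q N M A {1..M} L'"
      unfolding proper_array_def
    proof (intro conjI ballI impI)
      show "L' ` ({1..N} \<times> {1..M}) \<subseteq> {1..p * q}"
        using \<rho>M proper_array_range[OF L] by (auto simp: L'_def simp del: atLeastAtMost_iff)
      show "inj_on (\<lambda>b. L' (a, b)) {1..M}" if a: "a \<in> A" for a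
      proof (rule inj_onI)
        fix b b' assume b: "b \<in> {1..M}" "b' \<in> {1..M}" and "L' (a, b) = L' (a, b')"
        then have eq: "L (a, \<rho> a b) = L (a, \<rho> a b')" by (simp add: L'_def)
        have aN: "a \<in> {1..N}" using A a by blast
        have "\<rho> a b = \<rho> a b'" by (rule row[OF a \<rho>M[OF aN b(1)] \<rho>M[OF aN b(2)] eq])
        then show "b = b'" using \<rho>inj[OF aN] b by blast
      qed
      show "inj_on (\<lambda>a. L' (a, b)) {1..N}" if b: "b \<in> {1..M}" for b
      proof (cases "b \<in> ?C")
        case True
        then show ?thesis using col by (simp add: L'_def \<rho>_def)
      next
        case False
        then have "b \<in> {1..s}" using b by auto
        then show ?thesis using False proper_array_col[OF L] by (simp add: L'_def \<rho>_def)
      qed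
      show "v = w" if vw: "v \<in> {1..N} \<times> {1..M}" "w \<in> {1..N} \<times> {1..M}"
        "box p q v = box p q w \<and> L' v = L' w" for v w
      proof -
        obtain a b c d where v: "v = (a, b)" and w: "w = (c, d)" by (metis surj_pair)
        have m: "a \<in> {1..N}" "b \<in> {1..M}" "c \<in> {1..N}" "d \<in> {1..M}" using vw v w by auto
        have "(a, \<rho> a b) = (c, \<rho> c d)"
          by (rule proper_array_box[OF L]) (use vw v w m \<rho>M \<rho>block in \<open>auto simp: box_def L'_def simp del: atLeastAtMost_iff\<close>)
        then show ?thesis using \<rho>inj m v w by blast
      qed
    qed
    show "\<forall>v\<in>{1..N} \<times> {1..s}. L' v = L v"
      by (auto simp: L'_def \<rho>_def)
    have "card {v \<in> K \<times> {1..M}. L' v = \<sigma>} = card {v \<in> K \<times> {1..M}. L v = \<sigma>}"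
      if K: "K \<subseteq> {1..N}" for K \<sigma>
    proof -
      have "inj_on (\<lambda>(a, b). (a, \<rho> a b)) {v \<in> K \<times> {1..M}. L' v = \<sigma>}"
        using \<rho>inj K by (auto simp: inj_on_def)
      moreover have "(\<lambda>(a, b). (a, \<rho> a b)) ` {v \<in> K \<times> {1..M}. L' v = \<sigma>}
          = {v \<in> K \<times> {1..M}. L v = \<sigma>}" (is "?l = ?r")
      proof
        show "?l \<subseteq> ?r" using \<rho>M K by (auto simp: L'_def simp del: atLeastAtMost_iff)
        show "?r \<subseteq> ?l"
        proof
          fix v assume v: "v \<in> ?r"
          obtain a b where ab: "v = (a, b)" by (cases v)
          have a: "a \<in> {1..N}" "b \<in> {1..M}" using v ab K by auto
          then obtain b' where "b' \<in> {1..M}" "\<rho> a b' = b"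
            using \<rho>[OF a(1)] by (metis bij_betw_imp_surj_on imageE)
          then show "v \<in> ?l" using v ab by (auto simp: L'_def image_iff intro!: bexI[of _ "(a, b')"])
        qed
      qed
      ultimately show ?thesis using card_image by fastforce
    qed
    then show "\<forall>K\<subseteq>{1..N}. \<forall>\<sigma>.
        card {v \<in> K \<times> {1..M}. L' v = \<sigma>} = card {v \<in> K \<times> {1..M}. L v = \<sigma>}"
      by blast
  qed
qed

section \<open>Necessity of Hall's Condition\<close>

lemma finite_cells: "Q \<subseteq> cells n \<Longrightarrow> finite Q"
  by (rule finite_subset[of _ "cells n"]) (auto simp: cells_def)

lemma
  assumes "finite Q"
  shows hall_alpha_ge: "I \<subseteq> Q \<Longrightarrow> independent_cells p q I \<Longrightarrow> (\<And>v. v \<in> I \<Longrightarrow> \<sigma> \<in> LS v) \<Longrightarrow>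
      card I \<le> hall_alpha p q LS \<sigma> Q"
    and hall_alpha_attained: "\<exists>I\<subseteq>Q. independent_cells p q I \<and> (\<forall>v\<in>I. \<sigma> \<in> LS v) \<and>
      card I = hall_alpha p q LS \<sigma> Q"
proof -
  let ?S = "{card I | I. I \<subseteq> Q \<and> independent_cells p q I \<and> (\<forall>v\<in>I. \<sigma> \<in> LS v)}"
  have fin: "finite ?S" by (rule finite_subset[of _ "card ` Pow Q"]) (use assms in auto)
  show "card I \<le> hall_alpha p q LS \<sigma> Q"
    if "I \<subseteq> Q" "independent_cells p q I" "\<And>v. v \<in> I \<Longrightarrow> \<sigma> \<in> LS v"
    unfolding hall_alpha_def by (rule Max_ge[OF fin]) (use that in auto)
  have "?S \<noteq> {}" by (auto simp: independent_cells_def intro: exI[of _ "{}"])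
  from Max_in[OF fin this] show "\<exists>I\<subseteq>Q. independent_cells p q I \<and> (\<forall>v\<in>I. \<sigma> \<in> LS v) \<and>
      card I = hall_alpha p q LS \<sigma> Q"
    unfolding hall_alpha_def by auto
qed

lemma sudoku_square_no_repeat:
  assumes L: "sudoku_square p q L" and v: "v \<in> cells (p * q)" and w: "w \<in> cells (p * q)"
    and "same_line_or_big_cell p q v w" and eq: "L v = L w"
  shows "v = w"
proof -
  obtain a b c d where vw: "v = (a, b)" "w = (c, d)" by (metis surj_pair)
  let ?n = "p * q"
  have m: "a \<in> {1..?n}" "b \<in> {1..?n}" "c \<in> {1..?n}" "d \<in> {1..?n}"
    using v w vw by (auto simp: cells_def)
  have \<sigma>: "L v \<in> {1..?n}" using L v by (auto simp: sudoku_square_def latin_square_def)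
  have ex1: "\<forall>i\<in>{1..?n}. \<forall>\<sigma>\<in>{1..?n}. \<exists>!j. j \<in> {1..?n} \<and> L (i, j) = \<sigma>"
    "\<forall>j\<in>{1..?n}. \<forall>\<sigma>\<in>{1..?n}. \<exists>!i. i \<in> {1..?n} \<and> L (i, j) = \<sigma>"
    "\<forall>B\<in>big_cells p q. \<forall>\<sigma>\<in>{1..?n}. \<exists>!c. c \<in> B \<and> L c = \<sigma>"
    using L unfolding sudoku_square_def latin_square_def by simp_all
  from assms(4) consider "a = c" | "b = d" | "same_big_cell p q v w"
    by (auto simp: same_line_or_big_cell_def vw)
  then show ?thesis
  proof cases
    case 1
    have "\<exists>!j. j \<in> {1..?n} \<and> L (a, j) = L v"
      by (rule bspec[OF bspec[OF ex1(1) m(1)] \<sigma>])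
    then show ?thesis using 1 m eq vw by auto
  next
    case 2
    have "\<exists>!i. i \<in> {1..?n} \<and> L (i, b) = L v"
      by (rule bspec[OF bspec[OF ex1(2) m(2)] \<sigma>])
    then show ?thesis using 2 m eq vw by auto
  next
    case 3
    then obtain B where B: "B \<in> big_cells p q" "v \<in> B" "w \<in> B" by (auto simp: same_big_cell_def)
    have "\<exists>!c. c \<in> B \<and> L c = L v"
      by (rule bspec[OF bspec[OF ex1(3) B(1)] \<sigma>])
    then show ?thesis using B eq by auto
  qed
qed

text \<open>The cells of \<open>Q\<close> that carry \<open>\<sigma>\<close> in the completed square are independent and have
  \<open>\<sigma>\<close> in their lists; these sets partition \<open>Q\<close>.\<close>

lemma hall_condition_if_can_be_completed:
  assumes "can_be_completed p q P"
  shows "hall_condition p q P"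
  unfolding hall_condition_def hall_inequality_def
proof (intro allI impI)
  fix Q assume Q: "Q \<subseteq> cells (p * q)"
  obtain L where L: "sudoku_square p q L"
    and ext: "\<And>v \<sigma>. v \<in> cells (p * q) \<Longrightarrow> P v = Some \<sigma> \<Longrightarrow> L v = \<sigma>"
    using assms unfolding can_be_completed_def by blast
  have finQ: "finite Q" using Q by (rule finite_cells)
  have rng: "L v \<in> {1..p * q}" if "v \<in> cells (p * q)" for v
    using L that by (auto simp: sudoku_square_def latin_square_def)
  have lists: "L v \<in> hall_list p q P v" if v: "v \<in> cells (p * q)" for v
  proof (cases "P v")
    case None
    have "P w \<noteq> Some (L v)" if w: "w \<in> cells (p * q)" "same_line_or_big_cell p q v w" for w
      using sudoku_square_no_repeat[OF L v w] ext[OF w(1)] None by auto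
    then show ?thesis using None rng[OF v] by (auto simp: hall_list_def)
  next
    case (Some \<tau>)
    then show ?thesis using ext[OF v] by (simp add: hall_list_def)
  qed
  have "card Q = (\<Sum>\<sigma>\<in>{1..p * q}. card {v \<in> Q. L v = \<sigma>})"
    by (rule card_eq_sum_card_fibres) (use finQ rng Q in auto)
  also have "\<dots> \<le> (\<Sum>\<sigma>\<in>{1..p * q}. hall_alpha p q (hall_list p q P) \<sigma> Q)"
  proof (intro sum_mono hall_alpha_ge[OF finQ])
    fix \<sigma>
    show "{v \<in> Q. L v = \<sigma>} \<subseteq> Q" by blast
    show "\<sigma> \<in> hall_list p q P v" if "v \<in> {v \<in> Q. L v = \<sigma>}" for v
      using that lists Q by blast
    show "independent_cells p q {v \<in> Q. L v = \<sigma>}"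
      unfolding independent_cells_def
    proof (rule pairwiseI)
      fix v w assume vw: "v \<in> {v \<in> Q. L v = \<sigma>}" "w \<in> {v \<in> Q. L v = \<sigma>}" "v \<noteq> w"
      then have "v \<in> cells (p * q)" "w \<in> cells (p * q)" "L v = L w" using Q by auto
      from sudoku_square_no_repeat[OF L this(1,2) _ this(3)] vw(3)
      show "\<not> same_line_or_big_cell p q v w" by blast
    qed
  qed
  finally show "(\<Sum>\<sigma>\<in>{1..p * q}. hall_alpha p q (hall_list p q P) \<sigma> Q) \<ge> card Q" .
qed

section \<open>Rectangles of whole big cells\<close>

text \<open>In each band, the cells of the new big cell are matched to symbols absent from their rows. Join
  each row to its missing symbols: a row misses \<open>q * (p - Y)\<close> symbols, and a symbol, having occurred
  once in each of the \<open>Y\<close> earlier big cells of the band, is missing from \<open>p - Y\<close> of its rows. Since a row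
  has \<open>q\<close> new cells, double counting gives Hall's condition. A symbol then occurs at most \<open>X \<le> q\<close> times
  in the \<open>q\<close> new columns, so they can be straightened.\<close>

lemma add_stack:
  assumes p: "p \<ge> 1" and q: "q \<ge> 1" and X: "X \<le> q" and Y: "Y < p"
    and L: "proper_array p q (X * p) (Y * q) {1..X * p} {1..Y * q} L"
  obtains L' where "proper_array p q (X * p) (Suc Y * q) {1..X * p} {1..Suc Y * q} L'"
    and "\<And>v. v \<in> {1..X * p} \<times> {1..Y * q} \<Longrightarrow> L' v = L v"
proof -
  let ?n = "p * q" and ?N = "X * p" and ?s = "Y * q" and ?M = "Suc Y * q"
  let ?band = "\<lambda>b. {b * p + 1..b * p + p}"
  define missing where "missing a = {1..?n} - (\<lambda>c. L (a, c)) ` {1..?s}" for a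
  have card_missing: "card (missing a) = q * (p - Y)" if a: "a \<in> {1..?N}" for a
  proof -
    have "card ((\<lambda>c. L (a, c)) ` {1..?s}) = ?s"
      using card_image[OF proper_array_row[OF L a]] by simp
    moreover have "(\<lambda>c. L (a, c)) ` {1..?s} \<subseteq> {1..?n}"
      using proper_array_range[OF L] a by (auto simp del: atLeastAtMost_iff)
    ultimately show ?thesis
      unfolding missing_def by (subst card_Diff_subset) (auto simp: diff_mult_distrib2 mult.commute)
  qed
  have band_sub: "?band b \<subseteq> {1..?N}" if "b < X" for b
  proof -
    have "b * p + p \<le> X * p" using that mult_le_mono1[of "Suc b" X p] by simp
    then show ?thesis by auto
  qed
  have few_missing: "card {a \<in> ?band b. \<sigma> \<in> missing a} \<le> p - Y" if b: "b < X" and \<sigma>: "\<sigma> \<in> {1..?n}" for b \<sigma>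
  proof -
    have "\<exists>v. v \<in> big_cell p q b t \<and> L v = \<sigma>" if t: "t < Y" for t
    proof -
      let ?B = "big_cell p q b t"
      have "t * q + q \<le> Y * q" using t mult_le_mono1[of "Suc t" Y q] by simp
      then have B: "?B \<subseteq> {1..?N} \<times> {1..?s}"
        unfolding big_cell_eq using band_sub[OF b] by (intro Sigma_mono) auto
      have "inj_on L ?B"
      proof (rule inj_onI)
        fix v w assume "v \<in> ?B" "w \<in> ?B" "L v = L w"
        moreover from this have "v \<in> {1..?N} \<times> {1..?s}" "w \<in> {1..?N} \<times> {1..?s}" using B by blast+
        ultimately show "v = w"
          using proper_array_box[OF L, of v w] mem_big_cell_iff[OF p q] by metis
      qed
      then have "card (L ` ?B) = card {1..?n}"
        by (simp add: card_image big_cell_eq card_cartesian_product)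
      moreover have "L ` ?B \<subseteq> {1..?n}" using proper_array_range[OF L] B by blast
      ultimately have "L ` ?B = {1..?n}" by (intro card_subset_eq) auto
      then show ?thesis using \<sigma> by (metis imageE)
    qed
    then obtain g where g: "\<And>t. t < Y \<Longrightarrow> g t \<in> big_cell p q b t" "\<And>t. t < Y \<Longrightarrow> L (g t) = \<sigma>"
      by metis
    have gM: "fst (g t) \<in> ?band b" "snd (g t) \<in> {1..?s}" if "t < Y" for t
    proof -
      have "t * q + q \<le> Y * q" using that mult_le_mono1[of "Suc t" Y q] by simp
      then show "fst (g t) \<in> ?band b" "snd (g t) \<in> {1..?s}"
        using g(1)[OF that] by (auto simp: big_cell_eq)
    qed
    have gbox: "box p q (g t) = (b, t)" if "t < Y" for t
      using g(1)[OF that] mem_big_cell_iff[OF p q, of "g t" b t] by blast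
    have "inj_on (\<lambda>t. fst (g t)) {..<Y}"
    proof (rule inj_onI)
      fix t u assume tu: "t \<in> {..<Y}" "u \<in> {..<Y}" and eq: "fst (g t) = fst (g u)"
      have "fst (g t) \<in> {1..?N}" using gM(1)[of t] band_sub[OF b] tu by auto
      from inj_onD[OF proper_array_row[OF L this], of "snd (g t)" "snd (g u)"]
      have "snd (g t) = snd (g u)" using tu eq g(2) gM(2) by (metis lessThan_iff prod.collapse)
      then have "g t = g u" using eq by (simp add: prod_eq_iff)
      moreover have "box p q (g t) = (b, t)" "box p q (g u) = (b, u)"
        using gbox tu by blast+
      ultimately show "t = u" by (metis Pair_inject)
    qed
    then have "card ((\<lambda>t. fst (g t)) ` {..<Y}) = Y" by (simp add: card_image)
    moreover have "(\<lambda>t. fst (g t)) ` {..<Y} \<subseteq> ?band b - {a \<in> ?band b. \<sigma> \<in> missing a}"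
    proof
      fix a assume "a \<in> (\<lambda>t. fst (g t)) ` {..<Y}"
      then obtain t where t: "t < Y" "a = fst (g t)" by auto
      have "\<sigma> = L (a, snd (g t))" using g(2)[OF t(1)] t(2) by simp
      then have "\<sigma> \<notin> missing a" using gM(2)[OF t(1)] by (auto simp: missing_def)
      then show "a \<in> ?band b - {a \<in> ?band b. \<sigma> \<in> missing a}" using gM(1) t by auto
    qed
    ultimately have "Y \<le> card (?band b - {a \<in> ?band b. \<sigma> \<in> missing a})"
      by (metis (no_types, lifting) card_mono finite_Diff finite_atLeastAtMost)
    also have "card (?band b - {a \<in> ?band b. \<sigma> \<in> missing a}) = p - card {a \<in> ?band b. \<sigma> \<in> missing a}"
      by (subst card_Diff_subset) auto
    finally have "Y \<le> p - card {a \<in> ?band b. \<sigma> \<in> missing a}" .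
    moreover have "card {a \<in> ?band b. \<sigma> \<in> missing a} \<le> card (?band b)"
      by (rule card_mono) auto
    ultimately show ?thesis using Y by simp
  qed
  have "\<exists>f. inj_on f (big_cell p q b Y) \<and> (\<forall>v\<in>big_cell p q b Y. f v \<in> missing (fst v))"
    if b: "b < X" for b
  proof (rule hall_marriage)
    show "finite (big_cell p q b Y)" by (simp add: big_cell_eq)
    fix K assume K: "K \<subseteq> big_cell p q b Y"
    let ?U = "fst ` K" and ?W = "\<Union>v\<in>K. missing (fst v)"
    have U: "?U \<subseteq> ?band b" using K by (auto simp: big_cell_eq)
    have finU: "finite ?U" using U finite_subset by blast
    have W: "?W \<subseteq> {1..?n}" by (auto simp: missing_def)
    have finW: "finite ?W" using W finite_subset by blast
    have "K \<subseteq> ?U \<times> {Y * q + 1..Y * q + q}"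
    proof
      fix v assume "v \<in> K"
      then show "v \<in> ?U \<times> {Y * q + 1..Y * q + q}"
        using subsetD[OF K] by (auto simp: big_cell_eq mem_Times_iff)
    qed
    from card_mono[OF _ this] have "card K \<le> card ?U * q" using finU by (simp add: card_cartesian_product)
    \<comment> \<open>Double counting of the pairs of a row of \<open>K\<close> and a symbol missing from it.\<close>
    then have "card K * (p - Y) \<le> card ?U * (q * (p - Y))" by simp
    also have "\<dots> = (\<Sum>a\<in>?U. card (missing a))"
    proof -
      have "(\<Sum>a\<in>?U. card (missing a)) = (\<Sum>a\<in>?U. q * (p - Y))"
        by (rule sum.cong[OF refl], rule card_missing) (use U band_sub[OF b] in blast)
      then show ?thesis by simp
    qed
    also have "\<dots> = card (Sigma ?U missing)" using finU by (simp add: missing_def)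
    also have "\<dots> = (\<Sum>\<sigma>\<in>?W. card {z \<in> Sigma ?U missing. snd z = \<sigma>})"
      proof (rule card_eq_sum_card_fibres)
      show "finite (Sigma ?U missing)" using finU by (auto simp: missing_def)
      show "snd z \<in> ?W" if "z \<in> Sigma ?U missing" for z using that by fastforce
    qed (rule finW)
    also have "\<dots> \<le> (\<Sum>\<sigma>\<in>?W. p - Y)"
    proof (rule sum_mono)
      fix \<sigma> assume \<sigma>: "\<sigma> \<in> ?W"
      have "card {z \<in> Sigma ?U missing. snd z = \<sigma>} = card (fst ` {z \<in> Sigma ?U missing. snd z = \<sigma>})"
        by (rule card_image[symmetric]) (auto simp: inj_on_def)
      also have "\<dots> \<le> card {a \<in> ?band b. \<sigma> \<in> missing a}"
        by (rule card_mono) (use U in auto)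
      also have "\<dots> \<le> p - Y" using few_missing[OF b] \<sigma> W by blast
      finally show "card {z \<in> Sigma ?U missing. snd z = \<sigma>} \<le> p - Y" .
    qed
    also have "\<dots> = card ?W * (p - Y)" by simp
    finally show "card K \<le> card ?W" using Y by simp
  qed (simp add: missing_def)
  then obtain f where f: "\<And>b. b < X \<Longrightarrow> inj_on (f b) (big_cell p q b Y)"
    "\<And>b v. b < X \<Longrightarrow> v \<in> big_cell p q b Y \<Longrightarrow> f b v \<in> missing (fst v)"
    by metis
  define T where "T v = (if snd v \<le> ?s then L v else f (block p (fst v)) v)" for v
  have new: "block p (fst v) < X" "v \<in> big_cell p q (block p (fst v)) Y" "block q (snd v) = Y"
    if "v \<in> {1..?N} \<times> {?s + 1..?M}" for v
    using that p q block_less_iff[of p "fst v" X] block_eq_iff[of q "snd v" Y]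
    by (auto simp: mem_big_cell_iff box_def)
  have old: "block q b < Y" if "b \<in> {1..?s}" for b
    using that q by (simp add: block_less_iff)
  have splitM: "b \<in> {1..?s} \<or> b \<in> {?s + 1..?M}" if "b \<in> {1..?M}" for b
    using that by auto
  have T_new: "T v \<in> missing (fst v)" if "v \<in> {1..?N} \<times> {?s + 1..?M}" for v
    using f(2)[OF new(1,2)[OF that]] that by (auto simp: T_def)
  have T_old: "T v = L v" if "v \<in> {1..?N} \<times> {1..?s}" for v
    using that by (auto simp: T_def)
  have T_box: "v = w" if v: "v \<in> {1..?N} \<times> {1..?M}" and w: "w \<in> {1..?N} \<times> {1..?M}"
    and bx: "box p q v = box p q w" and eq: "T v = T w" for v w
  proof (cases "snd v \<in> {1..?s}")
    case True
    have lt: "block q (snd w) < Y" using old[OF True] bx by (simp add: box_def)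
    have "w \<notin> {1..?N} \<times> {?s + 1..?M}" using new(3)[of w] lt by blast
    then have "snd w \<in> {1..?s}" using w splitM[of "snd w"] by (auto simp: mem_Times_iff)
    with True v w have vw: "v \<in> {1..?N} \<times> {1..?s}" "w \<in> {1..?N} \<times> {1..?s}"
      by (simp_all add: mem_Times_iff)
    show ?thesis
      using proper_array_box[OF L vw bx] T_old[OF vw(1)] T_old[OF vw(2)] eq by simp
  next
    case False
    then have v': "v \<in> {1..?N} \<times> {?s + 1..?M}" using v splitM[of "snd v"] by (auto simp: mem_Times_iff)
    have "block q (snd w) = Y" using new(3)[OF v'] bx by (simp add: box_def)
    then have w': "w \<in> {1..?N} \<times> {?s + 1..?M}"
      using w splitM[of "snd w"] old[of "snd w"] by (auto simp: mem_Times_iff)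
    show ?thesis
    proof (rule inj_onD[OF f(1)[OF new(1)[OF v']]])
      have same: "block p (fst w) = block p (fst v)" using bx by (simp add: box_def)
      have "?s < snd v" "?s < snd w" using v' w' by (auto simp: mem_Times_iff)
      then show "f (block p (fst v)) v = f (block p (fst v)) w"
        using eq same by (simp add: T_def)
      show "v \<in> big_cell p q (block p (fst v)) Y" "w \<in> big_cell p q (block p (fst v)) Y"
        using new(2)[OF v'] new(2)[OF w'] same by simp_all
    qed
  qed
  have T: "proper_array p q ?N ?M {1..?N} {1..?s} T"
    unfolding proper_array_def
  proof (intro conjI ballI impI)
    show "T ` ({1..?N} \<times> {1..?M}) \<subseteq> {1..?n}"
    proof
      fix \<sigma> assume "\<sigma> \<in> T ` ({1..?N} \<times> {1..?M})"
      then obtain v where v: "v \<in> {1..?N} \<times> {1..?M}" "\<sigma> = T v" by blast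
      show "\<sigma> \<in> {1..?n}"
      proof (cases "snd v \<in> {1..?s}")
        case True
        then have "v \<in> {1..?N} \<times> {1..?s}" using v by (simp add: mem_Times_iff)
        then show ?thesis using v(2) T_old proper_array_range[OF L] by simp
      next
        case False
        then have "v \<in> {1..?N} \<times> {?s + 1..?M}" using v(1) splitM[of "snd v"] by (simp add: mem_Times_iff)
        from T_new[OF this] show ?thesis using v(2) by (simp add: missing_def)
      qed
    qed
  next
    fix a assume a: "a \<in> {1..?N}"
    have mixed: "T (a, b) \<noteq> T (a, c)" if b: "b \<in> {1..?s}" and c: "c \<in> {?s + 1..?M}" for b c
    proof -
      have "T (a, c) \<in> missing a" using T_new[of "(a, c)"] a c by simp
      moreover have "T (a, b) = L (a, b)" using T_old[of "(a, b)"] a b by simp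
      moreover have "L (a, b) \<notin> missing a" using b unfolding missing_def by blast
      ultimately show ?thesis by metis
    qed
    show "inj_on (\<lambda>b. T (a, b)) {1..?M}"
    proof (rule inj_onI)
      fix b c assume b: "b \<in> {1..?M}" and c: "c \<in> {1..?M}" and eq: "T (a, b) = T (a, c)"
      from splitM[OF b] splitM[OF c] mixed[of b c] mixed[of c b] eq
      consider "b \<in> {1..?s}" "c \<in> {1..?s}" | "b \<in> {?s + 1..?M}" "c \<in> {?s + 1..?M}" by metis
      then show "b = c"
      proof cases
        case 1
        then show ?thesis
          using inj_onD[OF proper_array_row[OF L a], of b c] T_old[of "(a, b)"] T_old[of "(a, c)"] a eq
          by (simp del: atLeastAtMost_iff)
      next
        case 2
        then have m: "(a, b) \<in> {1..?N} \<times> {?s + 1..?M}" "(a, c) \<in> {1..?N} \<times> {?s + 1..?M}"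
          using a by blast+
        have "block q b = block q c" using new(3)[OF m(1)] new(3)[OF m(2)] by simp
        then have bx: "box p q (a, b) = box p q (a, c)" by (simp add: box_def)
        have "(a, b) = (a, c)"
          by (rule T_box[OF _ _ bx eq]) (use a b c in blast)+
        then show ?thesis by simp
      qed
    qed
  next
    fix b assume b: "b \<in> {1..?s}"
    then show "inj_on (\<lambda>a. T (a, b)) {1..?N}"
      using proper_array_col[OF L b] by (simp add: T_def)
  qed (use T_box in blast)
  have few: "card {v \<in> {1..?N} \<times> {?s + 1..?M}. T v = \<sigma>} \<le> ?M - ?s" for \<sigma>
  proof -
    let ?V = "{v \<in> {1..?N} \<times> {?s + 1..?M}. T v = \<sigma>}"
    have "inj_on (\<lambda>v. block p (fst v)) ?V"
    proof (rule inj_onI)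
      fix v w assume v: "v \<in> ?V" and w: "w \<in> ?V" and bl: "block p (fst v) = block p (fst w)"
      have m: "v \<in> {1..?N} \<times> {?s + 1..?M}" "w \<in> {1..?N} \<times> {?s + 1..?M}"
        and eq: "T v = T w"
        using v w by (blast, blast, simp)
      from m have "v \<in> {1..?N} \<times> {1..?M}" "w \<in> {1..?N} \<times> {1..?M}" by (auto simp: mem_Times_iff)
      moreover have "box p q v = box p q w"
        using bl new(3)[OF m(1)] new(3)[OF m(2)] by (simp add: box_def)
      ultimately show "v = w" using eq by (rule T_box)
    qed
    then have "card ?V = card ((\<lambda>v. block p (fst v)) ` ?V)" by (simp add: card_image)
    also have "\<dots> \<le> card {..<X}" by (rule card_mono) (use new(1) in auto)
    finally show ?thesis using X by simp
  qed
  have stack: "block q b = Y" if "b \<in> {?s + 1..?M}" for b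
    using that q by (subst block_eq_iff) auto
  have sM: "?s \<le> ?M" by simp
  obtain L' where L': "proper_array p q ?N ?M {1..?N} {1..?M} L'"
    "\<forall>v\<in>{1..?N} \<times> {1..?s}. L' v = T v"
    by (rule straighten_columns[OF T order_refl sM stack few]) (assumption | rule that)+
  show thesis by (rule that[OF L'(1)]) (use L'(2) T_old in metis)
qed

lemma add_stacks:
  assumes p: "p \<ge> 1" and q: "q \<ge> 1" and X: "X \<le> q" and "Y + k \<le> p"
    and L: "proper_array p q (X * p) (Y * q) {1..X * p} {1..Y * q} L"
  shows "\<exists>L'. proper_array p q (X * p) ((Y + k) * q) {1..X * p} {1..(Y + k) * q} L' \<and>
    (\<forall>v\<in>{1..X * p} \<times> {1..Y * q}. L' v = L v)"
  using assms(4)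
proof (induction k)
  case 0
  then show ?case using L by auto
next
  case (Suc k)
  then obtain L1 where L1: "proper_array p q (X * p) ((Y + k) * q) {1..X * p} {1..(Y + k) * q} L1"
    "\<forall>v\<in>{1..X * p} \<times> {1..Y * q}. L1 v = L v" by auto
  have "Y + k < p" using Suc.prems by simp
  then obtain L2 where L2: "proper_array p q (X * p) (Suc (Y + k) * q) {1..X * p} {1..Suc (Y + k) * q} L2"
    "\<And>v. v \<in> {1..X * p} \<times> {1..(Y + k) * q} \<Longrightarrow> L2 v = L1 v"
    using add_stack[OF p q X _ L1(1)] by blast
  have "Y * q \<le> (Y + k) * q" by simp
  then have sub: "{1..X * p} \<times> {1..Y * q} \<subseteq> {1..X * p} \<times> {1..(Y + k) * q}"
    by (intro Sigma_mono) auto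
  have "L2 v = L v" if "v \<in> {1..X * p} \<times> {1..Y * q}" for v
    using bspec[OF L1(2) that] L2(2)[OF subsetD[OF sub that]] by (rule trans[rotated])
  then show ?case using L2(1) by auto
qed

text \<open>Missing stacks are added first, then, after transposition, missing bands.\<close>

lemma complete_big_cells:
  assumes p: "p \<ge> 1" and q: "q \<ge> 1" and X: "X \<le> q" and Y: "Y \<le> p"
    and L: "proper_array p q (X * p) (Y * q) {1..X * p} {1..Y * q} L"
  shows "\<exists>L'. sudoku_square p q L' \<and> (\<forall>v\<in>{1..X * p} \<times> {1..Y * q}. L' v = L v)"
proof -
  obtain L1 where L1: "proper_array p q (X * p) (p * q) {1..X * p} {1..p * q} L1"
    "\<And>v. v \<in> {1..X * p} \<times> {1..Y * q} \<Longrightarrow> L1 v = L v"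
    using add_stacks[OF p q X _ L, of "p - Y"] Y by auto
  have "proper_array q p (p * q) (X * p) {1..p * q} {1..X * p} (\<lambda>(b, a). L1 (a, b))"
    using proper_array_transpose[OF L1(1)] .
  from add_stacks[OF q p _ _ this, of "q - X"] X
  obtain L2 where L2: "proper_array q p (p * q) (q * p) {1..p * q} {1..q * p} L2"
    "\<And>a b. a \<in> {1..X * p} \<Longrightarrow> b \<in> {1..p * q} \<Longrightarrow> L2 (b, a) = L1 (a, b)"
    by auto
  let ?L = "\<lambda>(a, b). L2 (b, a)"
  have "proper_array p q (p * q) (p * q) {1..p * q} {1..p * q} ?L"
    using proper_array_transpose[OF L2(1)] by (simp add: mult.commute)
  then have "sudoku_square p q ?L" by (rule sudoku_square_if_proper_array[OF p q])
  moreover have "?L v = L v" if v: "v \<in> {1..X * p} \<times> {1..Y * q}" for v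
  proof -
    have "Y * q \<le> p * q" using Y by (rule mult_le_mono1)
    moreover have "1 \<le> snd v" "snd v \<le> Y * q" using v by (auto simp: mem_Times_iff)
    ultimately have "snd v \<in> {1..p * q}" unfolding atLeastAtMost_iff by linarith
    then show ?thesis using v L1(2)[OF v] L2(2)[of "fst v" "snd v"]
      by (simp add: mem_Times_iff case_prod_unfold)
  qed
  ultimately show ?thesis by blast
qed

section \<open>Using Hall's Condition at the border of the rectangle\<close>

text \<open>The names fixed below are those of the introduction: \<open>x\<close> and \<open>y\<close> index the last band and stack
  met by the rectangle \<open>D0\<close>, and \<open>D\<close> is \<open>D0\<close> rounded up to whole big cells. When \<open>p\<close> divides \<open>r\<close>,
  band \<open>x\<close> is the last full band, and \<open>N = r\<close>.\<close>

locale hall_corner =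
  fixes p q r s :: nat and R :: "cell \<Rightarrow> nat"
  assumes p: "p \<ge> 1" and q: "q \<ge> 1" and r: "1 \<le> r" "r \<le> p * q" and s: "1 \<le> s" "s \<le> p * q"
    and R: "sudoku_rectangle p q r s R"
    and hall: "hall_condition p q (top_left r s R)"
begin

abbreviation n where "n \<equiv> p * q"
abbreviation x where "x \<equiv> block p r"
abbreviation y where "y \<equiv> block q s"
abbreviation N where "N \<equiv> Suc x * p"
abbreviation M where "M \<equiv> Suc y * q"
abbreviation D0 where "D0 \<equiv> {1..r} \<times> {1..s}"
abbreviation D where "D \<equiv> {1..N} \<times> {1..M}"
abbreviation bx where "bx \<equiv> box p q"
abbreviation symbols where "symbols \<equiv> hall_list p q (top_left r s R)"

text \<open>The index pairs of the big cells of \<open>D\<close> that lie in its last band or last stack; all empty cells of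
  \<open>D\<close> lie there.\<close>

definition border :: "(nat \<times> nat) set" where
  "border = {..x} \<times> {y} \<union> {x} \<times> {..y}"

text \<open>An independent system attaining the largest possible size, one cell in every border big cell.\<close>

definition full_system :: "nat \<Rightarrow> cell set \<Rightarrow> bool" where
  "full_system \<sigma> I \<longleftrightarrow> I \<subseteq> {v \<in> cells n. bx v \<in> border} \<and> independent_cells p q I \<and>
     bx ` I = border \<and> (\<forall>v\<in>I. \<sigma> \<in> symbols v)"

lemma corner_bounds: "x < q" "y < p" "x * p < r" "r \<le> N" "y * q < s" "s \<le> M" "N \<le> n" "M \<le> n"
proof -
  show xq: "x < q" and yp: "y < p"
    using r s p q by (auto simp: block_less_iff mult.commute)
  show "x * p < r" "r \<le> N" "y * q < s" "s \<le> M"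
    using block_eq_iff[OF p r(1), of x] block_eq_iff[OF q s(1), of y] by auto
  show "N \<le> n" using xq mult_le_mono1[of "Suc x" q p] by (simp add: mult.commute)
  show "M \<le> n" using yp mult_le_mono1[of "Suc y" p q] by simp
qed

lemma D_subset: "D0 \<subseteq> D" "D \<subseteq> cells n"
  using corner_bounds by (auto simp: cells_def)

lemma row_block: "a \<in> {1..N} \<Longrightarrow> block p a \<le> x" "r \<le> a \<Longrightarrow> a \<in> {1..N} \<Longrightarrow> block p a = x"
  using block_le_iff[OF p, of a x] block_mono[of r a p] by auto

lemma col_block: "b \<in> {1..M} \<Longrightarrow> block q b \<le> y" "s \<le> b \<Longrightarrow> b \<in> {1..M} \<Longrightarrow> block q b = y"
  using block_le_iff[OF q, of b y] block_mono[of s b q] by auto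

lemma bx_empty_in_border: "v \<in> D - D0 \<Longrightarrow> bx v \<in> border"
  using row_block[of "fst v"] col_block[of "snd v"]
  by (auto simp: border_def box_def mem_Times_iff)

lemma border_subset: "border \<subseteq> {..<q} \<times> {..<p}"
  using corner_bounds by (auto simp: border_def)

lemma finite_border: "finite border"
  by (simp add: border_def)

lemma in_D_if_border: "v \<in> cells n \<Longrightarrow> bx v \<in> border \<Longrightarrow> v \<in> D"
  using block_le_iff[OF p, of "fst v" x] block_le_iff[OF q, of "snd v" y]
  by (auto simp: border_def box_def cells_def mem_Times_iff)

lemma symbols_filled: "v \<in> D0 \<Longrightarrow> symbols v = {R v}"
  by (simp add: hall_list_def top_left_def)

lemma symbols_empty:
  assumes v: "v \<in> D - D0" and \<sigma>: "\<sigma> \<in> symbols v" and w: "w \<in> D0"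
    and "fst v = fst w \<or> snd v = snd w \<or> bx v = bx w"
  shows "R w \<noteq> \<sigma>"
proof -
  have c: "v \<in> cells n" "w \<in> cells n" using v w D_subset by blast+
  then have "same_line_or_big_cell p q v w"
    using assms(4) same_big_cell_iff[OF p q c] by (auto simp: same_line_or_big_cell_def)
  moreover have "top_left r s R v = None" "top_left r s R w = Some (R w)"
    using v w by (simp_all add: top_left_def)
  ultimately show ?thesis using \<sigma> c by (auto simp: hall_list_def)
qed

lemma independent_inj_on:
  assumes I: "independent_cells p q I" and sub: "I \<subseteq> cells n"
  shows "inj_on bx I" "inj_on fst I" "inj_on snd I"
proof -
  have "v = w" if "v \<in> I" "w \<in> I" "fst v = fst w \<or> snd v = snd w \<or> bx v = bx w" for v w
  proof (rule ccontr)
    assume "v \<noteq> w"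
    then have "\<not> same_line_or_big_cell p q v w"
      using I that by (auto simp: independent_cells_def pairwise_def)
    then show False
      using that sub same_big_cell_iff[OF p q, of v w] by (auto simp: same_line_or_big_cell_def)
  qed
  then show "inj_on bx I" "inj_on fst I" "inj_on snd I" by (auto simp: inj_on_def)
qed

text \<open>In \<open>Q\<close>, which is \<open>W\<close> together with the other border big cells, a symbol has at most
  one independent cell per border big cell. If fewer than \<open>|W|\<close> symbols attained this bound, the
  sum in Hall's Inequality would be below \<open>|Q| = |W| + (card border - 1) * n\<close>.\<close>

lemma many_symbols:
  assumes \<beta>: "\<beta> \<in> border" and W: "W \<subseteq> {v \<in> cells n. bx v = \<beta>}"
  shows "card W \<le> card {\<sigma> \<in> {1..n}. \<exists>I. full_system \<sigma> I \<and> I \<inter> W \<noteq> {}}" (is "_ \<le> card ?G")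
proof -
  let ?rest = "{v \<in> cells n. bx v \<in> border - {\<beta>}}"
  define Q where "Q = W \<union> ?rest"
  define m where "m = card border - 1"
  have m: "card border = Suc m"
    using \<beta> finite_border unfolding m_def by (metis card_Suc_Diff1 card_Diff_singleton)
  have Qc: "Q \<subseteq> cells n" using W by (auto simp: Q_def)
  then have finQ: "finite Q" by (rule finite_cells)
  have "card ?rest = (\<Sum>\<gamma>\<in>border - {\<beta>}. card {v \<in> ?rest. bx v = \<gamma>})"
    by (rule card_eq_sum_card_fibres) (use finite_border finite_cells[of ?rest n] in auto)
  also have "\<dots> = (\<Sum>\<gamma>\<in>border - {\<beta>}. n)"
  proof (rule sum.cong[OF refl])
    fix \<gamma> assume \<gamma>: "\<gamma> \<in> border - {\<beta>}"
    then have "{v \<in> ?rest. bx v = \<gamma>} = {v \<in> cells n. bx v = (fst \<gamma>, snd \<gamma>)}" by auto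
    also have "card \<dots> = n"
      by (rule card_box_fibre[OF p q]) (use \<gamma> border_subset in auto)
    finally show "card {v \<in> ?rest. bx v = \<gamma>} = n" .
  qed
  also have "\<dots> = m * n" using \<beta> m finite_border by simp
  finally have rest: "card ?rest = m * n" .
  have "card Q = card W + card ?rest"
    unfolding Q_def by (rule card_Un_disjoint) (use W finQ in \<open>auto simp: Q_def\<close>)
  then have cardQ: "card Q = card W + m * n" using rest by simp
  have "hall_alpha p q symbols \<sigma> Q \<le> m + (if \<sigma> \<in> ?G then 1 else 0)" if \<sigma>: "\<sigma> \<in> {1..n}" for \<sigma>
  proof -
    obtain I where I: "I \<subseteq> Q" "independent_cells p q I" "\<forall>v\<in>I. \<sigma> \<in> symbols v"
      "card I = hall_alpha p q symbols \<sigma> Q"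
      using hall_alpha_attained[OF finQ, where p = p and q = q and \<sigma> = \<sigma> and LS = symbols] by blast
    have IB: "bx ` I \<subseteq> border"
    proof (rule image_subsetI)
      fix v assume "v \<in> I"
      then have "v \<in> Q" using I(1) by blast
      then show "bx v \<in> border" using \<beta> W by (auto simp: Q_def)
    qed
    have c: "card (bx ` I) = card I"
      using independent_inj_on(1)[OF I(2)] I(1) Qc by (intro card_image) auto
    have le: "card I \<le> Suc m" using card_mono[OF finite_border IB] c m by simp
    show ?thesis
    proof (cases "card I = Suc m")
      case True
      then have eq: "bx ` I = border" using IB c m finite_border by (intro card_subset_eq) auto
      then obtain v where "v \<in> I" "bx v = \<beta>" using \<beta> by (metis imageE)
      then have "I \<inter> W \<noteq> {}" using I(1) by (auto simp: Q_def)
      moreover have "full_system \<sigma> I" using I eq IB Qc by (auto simp: full_system_def)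
      ultimately have "\<sigma> \<in> ?G" using \<sigma> by blast
      then show ?thesis using I(4) le by simp
    qed (use I(4) le in auto)
  qed
  then have "(\<Sum>\<sigma>\<in>{1..n}. hall_alpha p q symbols \<sigma> Q) \<le>
      (\<Sum>\<sigma>\<in>{1..n}. m + (if \<sigma> \<in> ?G then 1 else 0))"
    by (rule sum_mono)
  also have "\<dots> = n * m + card ?G"
  proof -
    have "{1..n} \<inter> ?G = ?G" by blast
    then show ?thesis by (simp add: sum.distrib sum.If_cases Int_def)
  qed
  finally have "(\<Sum>\<sigma>\<in>{1..n}. hall_alpha p q symbols \<sigma> Q) \<le> n * m + card ?G" .
  moreover have "card Q \<le> (\<Sum>\<sigma>\<in>{1..n}. hall_alpha p q symbols \<sigma> Q)"
    using hall Qc by (auto simp: hall_condition_def hall_inequality_def)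
  ultimately show ?thesis using cardQ by (simp add: mult.commute)
qed

text \<open>For a set \<open>K\<close> of empty cells in one border big cell, the symbols counted in \<open>many_symbols\<close> are the
  candidates for the cells of \<open>K\<close>, so that lemma is the hypothesis of the marriage theorem.\<close>

lemma transversal:
  assumes \<beta>: "\<beta> \<in> border"
  shows "\<exists>f. inj_on f {v \<in> cells n - D0. bx v = \<beta>} \<and>
    (\<forall>v\<in>{v \<in> cells n - D0. bx v = \<beta>}. f v \<in> {\<sigma> \<in> {1..n}. \<exists>I. full_system \<sigma> I \<and> v \<in> I})"
proof (rule hall_marriage)
  show "finite {v \<in> cells n - D0. bx v = \<beta>}" by (rule finite_cells[of _ n]) auto
  fix K assume K: "K \<subseteq> {v \<in> cells n - D0. bx v = \<beta>}"
  then have "card K \<le> card {\<sigma> \<in> {1..n}. \<exists>I. full_system \<sigma> I \<and> I \<inter> K \<noteq> {}}"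
    by (intro many_symbols[OF \<beta>]) auto
  also have "{\<sigma> \<in> {1..n}. \<exists>I. full_system \<sigma> I \<and> I \<inter> K \<noteq> {}} =
      (\<Union>v\<in>K. {\<sigma> \<in> {1..n}. \<exists>I. full_system \<sigma> I \<and> v \<in> I})"
    by blast
  finally show "card K \<le> card \<dots>" .
qed simp

lemma R_distinct:
  assumes "v \<in> D0" "w \<in> D0" "fst v = fst w \<or> snd v = snd w \<or> bx v = bx w" "R v = R w"
  shows "v = w"
proof (rule ccontr)
  assume ne: "v \<noteq> w"
  have c: "v \<in> cells n" "w \<in> cells n" using assms D_subset by blast+
  have "same_line_or_big_cell p q v w"
    using assms(3) same_big_cell_iff[OF p q c] by (auto simp: same_line_or_big_cell_def)
  moreover have "\<forall>v\<in>cells n. \<forall>w\<in>cells n. v \<noteq> w \<and> same_line_or_big_cell p q v w \<and>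
      top_left r s R v \<noteq> None \<longrightarrow> top_left r s R v \<noteq> top_left r s R w"
    using partial_sudoku_square_top_left[OF R] unfolding partial_sudoku_square_def by (rule conjunct2)
  moreover have "top_left r s R v = Some (R v)" "top_left r s R w = Some (R w)"
    using assms(1,2) by (simp_all add: top_left_def)
  ultimately show False using c ne assms(4) by (metis option.distinct(1))
qed

text \<open>Since candidates of an empty cell belong to its list, clashes with \<open>R\<close> are excluded. Two empty
  cells in a row \<open>a \<le> r\<close> both lie in stack \<open>y\<close>, hence in the same big cell, where the filling is
  injective; the same holds for columns \<open>b \<le> s\<close>.\<close>

lemma provisional_filling:
  obtains T where "\<And>v. v \<in> D0 \<Longrightarrow> T v = R v"
    and "proper_array p q N M {1..r} {1..s} T"
    and "\<And>v. v \<in> D - D0 \<Longrightarrow> \<exists>I. full_system (T v) I \<and> v \<in> I"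
proof -
  have "\<exists>f. \<forall>\<beta>\<in>border. inj_on (f \<beta>) {v \<in> cells n - D0. bx v = \<beta>} \<and>
      (\<forall>v\<in>{v \<in> cells n - D0. bx v = \<beta>}. f \<beta> v \<in> {\<sigma> \<in> {1..n}. \<exists>I. full_system \<sigma> I \<and> v \<in> I})"
    by (rule bchoice) (rule ballI, rule transversal)
  then obtain f where f: "\<And>\<beta>. \<beta> \<in> border \<Longrightarrow> inj_on (f \<beta>) {v \<in> cells n - D0. bx v = \<beta>}"
    "\<And>\<beta> v. \<beta> \<in> border \<Longrightarrow> v \<in> {v \<in> cells n - D0. bx v = \<beta>} \<Longrightarrow>
      f \<beta> v \<in> {\<sigma> \<in> {1..n}. \<exists>I. full_system \<sigma> I \<and> v \<in> I}"
    by blast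
  define T where "T v = (if v \<in> D0 then R v else f (bx v) v)" for v
  have T_filled: "T v = R v" if "v \<in> D0" for v using that by (simp add: T_def)
  have T_empty: "T v \<in> {1..n}" "\<exists>I. full_system (T v) I \<and> v \<in> I" if "v \<in> D - D0" for v
  proof -
    have "v \<in> {w \<in> cells n - D0. bx w = bx v}" using that D_subset by auto
    from f(2)[OF bx_empty_in_border[OF that] this]
    show "T v \<in> {1..n}" "\<exists>I. full_system (T v) I \<and> v \<in> I" using that by (auto simp: T_def)
  qed
  have mixed: "T v \<noteq> T w"
    if "v \<in> D - D0" "w \<in> D0" "fst v = fst w \<or> snd v = snd w \<or> bx v = bx w" for v w
  proof -
    have "T v \<in> symbols v" using T_empty(2)[OF that(1)] by (auto simp: full_system_def)
    from symbols_empty[OF that(1) this that(2,3)] show ?thesis using T_filled[OF that(2)] by simp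
  qed
  have T_distinct: "v = w"
    if v: "v \<in> D" and w: "w \<in> D" and eq: "T v = T w"
      and line: "fst v = fst w \<or> snd v = snd w \<or> bx v = bx w"
      and bx: "v \<notin> D0 \<Longrightarrow> w \<notin> D0 \<Longrightarrow> bx v = bx w" for v w
  proof (cases "v \<in> D0"; cases "w \<in> D0")
    assume "v \<in> D0" "w \<in> D0"
    then show ?thesis using R_distinct line eq T_filled by simp
  next
    assume "v \<in> D0" "w \<notin> D0"
    then have "w \<in> D - D0" using w by blast
    then show ?thesis using mixed[of w v] \<open>v \<in> D0\<close> line eq by metis
  next
    assume "v \<notin> D0" "w \<in> D0"
    then have "v \<in> D - D0" using v by blast
    then show ?thesis using mixed[of v w] \<open>w \<in> D0\<close> line eq by metis
  next
    assume e: "v \<notin> D0" "w \<notin> D0"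
    then have b: "bx v \<in> border" using v bx_empty_in_border by blast
    have "v \<in> cells n - D0" "w \<in> cells n - D0" using v w e D_subset by blast+
    then show ?thesis
      using inj_onD[OF f(1)[OF b], of v w] bx[OF e] eq e by (simp add: T_def)
  qed
  have "proper_array p q N M {1..r} {1..s} T"
    unfolding proper_array_def
  proof (intro conjI ballI impI)
    show "T ` D \<subseteq> {1..n}"
    proof
      fix \<sigma> assume "\<sigma> \<in> T ` D"
      then obtain v where v: "v \<in> D" "\<sigma> = T v" by blast
      show "\<sigma> \<in> {1..n}"
      proof (cases "v \<in> D0")
        case True
        have "R v \<in> {1..n}" using R True unfolding sudoku_rectangle_def latin_rectangle_def by blast
        then show ?thesis using v(2) T_filled[OF True] by simp
      qed (use v T_empty(1)[of v] in blast)
    qed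
    show "inj_on (\<lambda>b. T (a, b)) {1..M}" if a: "a \<in> {1..r}" for a
    proof (rule inj_onI)
      fix b c assume bc: "b \<in> {1..M}" "c \<in> {1..M}" "T (a, b) = T (a, c)"
      have aN: "a \<in> {1..N}" using a corner_bounds(4) by auto
      have "(a, b) = (a, c)"
      proof (rule T_distinct)
        show "bx (a, b) = bx (a, c)" if "(a, b) \<notin> D0" "(a, c) \<notin> D0"
          using that a col_block(2)[of b] col_block(2)[of c] bc by (auto simp: box_def)
      qed (use bc aN in \<open>auto simp del: atLeastAtMost_iff\<close>)
      then show "b = c" by simp
    qed
    show "inj_on (\<lambda>a. T (a, b)) {1..N}" if b: "b \<in> {1..s}" for b
    proof (rule inj_onI)
      fix a c assume ac: "a \<in> {1..N}" "c \<in> {1..N}" "T (a, b) = T (c, b)"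
      have bM: "b \<in> {1..M}" using b corner_bounds(6) by auto
      have "(a, b) = (c, b)"
      proof (rule T_distinct)
        show "bx (a, b) = bx (c, b)" if "(a, b) \<notin> D0" "(c, b) \<notin> D0"
          using that b row_block(2)[of a] row_block(2)[of c] ac by (auto simp: box_def)
      qed (use ac bM in \<open>auto simp del: atLeastAtMost_iff\<close>)
      then show "a = c" by simp
    qed
    show "v = w" if "v \<in> D" "w \<in> D" "bx v = bx w \<and> T v = T w" for v w
      using T_distinct[OF that(1,2) conjunct2[OF that(3)]] that(3) by blast
  qed
  then show thesis using that T_filled T_empty(2) by blast
qed

text \<open>If \<open>T\<close> has \<open>\<sigma>\<close> on an empty cell of a big cell, then \<open>R\<close> has no \<open>\<sigma>\<close> in that big cell, so the
  cell of a full system there is empty as well; outside the corner big cell this settles on which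
  side of \<open>D0\<close> it lies. In the corner, an empty cell may lie to the right, below, or both, so the
  system must be chosen through the very cell that carries \<open>\<sigma>\<close>; this is why the candidates for
  a cell were restricted to symbols with a full system through it.\<close>

lemma matching_system:
  assumes T_filled: "\<And>v. v \<in> D0 \<Longrightarrow> T v = R v"
    and T: "proper_array p q N M {1..r} {1..s} T"
    and full: "\<And>v. v \<in> D - D0 \<Longrightarrow> \<exists>I. full_system (T v) I \<and> v \<in> I"
  shows "\<exists>I. independent_cells p q I \<and> I \<subseteq> D - D0 \<and>
    (\<forall>u\<in>D - D0. T u = \<sigma> \<longrightarrow> (\<exists>w\<in>I. bx w = bx u \<and> (bx u = (x, y) \<longrightarrow> w = u)))"
proof (cases "\<exists>u\<in>D - D0. T u = \<sigma>")
  case False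
  then show ?thesis by (auto simp: independent_cells_def intro!: exI[of _ "{}"])
next
  case True
  have box: "v = w" if "v \<in> D" "w \<in> D" "bx v = bx w" "T v = T w" for v w
    using proper_array_box[OF T] that by blast
  have "\<exists>I. full_system \<sigma> I \<and> (\<forall>u\<in>D - D0. T u = \<sigma> \<and> bx u = (x, y) \<longrightarrow> u \<in> I)"
  proof (cases "\<exists>u\<in>D - D0. T u = \<sigma> \<and> bx u = (x, y)")
    case True
    then obtain u where u: "u \<in> D - D0" "T u = \<sigma>" "bx u = (x, y)" by blast
    then obtain I where I: "full_system \<sigma> I" "u \<in> I" using full by blast
    have "v \<in> I" if "v \<in> D - D0" "T v = \<sigma> \<and> bx v = (x, y)" for v
      using box[of v u] that u I(2) by force
    then show ?thesis using I(1) by blast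
  next
    case False
    then show ?thesis using True full by blast
  qed
  then obtain I where I: "full_system \<sigma> I"
    "\<And>u. u \<in> D - D0 \<Longrightarrow> T u = \<sigma> \<Longrightarrow> bx u = (x, y) \<Longrightarrow> u \<in> I" by blast
  have Isub: "I \<subseteq> D" using I(1) in_D_if_border by (auto simp: full_system_def)
  have "\<exists>w\<in>I - D0. bx w = bx u \<and> (bx u = (x, y) \<longrightarrow> w = u)" if u: "u \<in> D - D0" "T u = \<sigma>" for u
  proof (cases "bx u = (x, y)")
    case True
    then show ?thesis using I(2) u by blast
  next
    case False
    have "bx u \<in> bx ` I" using I(1) bx_empty_in_border[OF u(1)] by (simp add: full_system_def)
    then obtain w where w: "w \<in> I" "bx w = bx u" by (metis imageE)
    have "w \<notin> D0"
    proof
      assume w0: "w \<in> D0"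
      have "\<sigma> \<in> symbols w" using I(1) w(1) by (simp add: full_system_def)
      then have "T w = T u" using symbols_filled[OF w0] T_filled[OF w0] u(2) by simp
      then have "w = u" using box w Isub u(1) by blast
      then show False using w0 u(1) by blast
    qed
    then show ?thesis using w False by blast
  qed
  moreover have "independent_cells p q (I - D0)"
    using I(1) by (auto simp: full_system_def independent_cells_def pairwise_def)
  ultimately show ?thesis using Isub by (intro exI[of _ "I - D0"]) blast
qed

text \<open>Send an occurrence \<open>u\<close> of \<open>\<sigma>\<close> in the new columns to the cell of the system in the same big cell. Above
  the corner that cell is empty, hence also in a new column, and in the corner it is \<open>u\<close> itself.
  Independence makes the columns distinct, so there are at most \<open>M - s\<close> occurrences. Rows are analogous.\<close>

lemma few_right_and_bottom:
  assumes T_filled: "\<And>v. v \<in> D0 \<Longrightarrow> T v = R v"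
    and T: "proper_array p q N M {1..r} {1..s} T"
    and full: "\<And>v. v \<in> D - D0 \<Longrightarrow> \<exists>I. full_system (T v) I \<and> v \<in> I"
  shows "card {v \<in> {1..N} \<times> {s + 1..M}. T v = \<sigma>} \<le> M - s"
    and "card {v \<in> {r + 1..N} \<times> {1..M}. T v = \<sigma>} \<le> N - r"
proof -
  obtain I where I: "independent_cells p q I" "I \<subseteq> D - D0"
    and "\<forall>u\<in>D - D0. T u = \<sigma> \<longrightarrow> (\<exists>w\<in>I. bx w = bx u \<and> (bx u = (x, y) \<longrightarrow> w = u))"
    using matching_system[OF assms] by blast
  then have "\<forall>u\<in>{u \<in> D - D0. T u = \<sigma>}. \<exists>w. w \<in> I \<and> bx w = bx u \<and> (bx u = (x, y) \<longrightarrow> w = u)"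
    by blast
  from bchoice[OF this] obtain w where
    W: "\<forall>u\<in>{u \<in> D - D0. T u = \<sigma>}. w u \<in> I \<and> bx (w u) = bx u \<and> (bx u = (x, y) \<longrightarrow> w u = u)"
    by (rule exE)
  have w: "w u \<in> I" "bx (w u) = bx u" "bx u = (x, y) \<Longrightarrow> w u = u" if "u \<in> D - D0" "T u = \<sigma>" for u
  proof -
    have "u \<in> {u \<in> D - D0. T u = \<sigma>}" using that by blast
    from bspec[OF W this] show "w u \<in> I" "bx (w u) = bx u" "bx u = (x, y) \<Longrightarrow> w u = u"
      by blast+
  qed
  have Ic: "I \<subseteq> cells n" using I(2) D_subset by blast
  have inj: "inj_on (\<lambda>u. g (w u)) V"
    if g: "inj_on g I" and V: "V \<subseteq> {u \<in> D - D0. T u = \<sigma>}" for g :: "cell \<Rightarrow> nat" and V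
  proof (rule inj_onI)
    fix u v assume uv: "u \<in> V" "v \<in> V" "g (w u) = g (w v)"
    then have m: "u \<in> D - D0" "T u = \<sigma>" "v \<in> D - D0" "T v = \<sigma>" using V by auto
    have "w u = w v" by (rule inj_onD[OF g uv(3)]) (use w(1) m in auto)
    then have "bx u = bx v" using w(2) m by metis
    then show "u = v" using proper_array_box[OF T, of u v] m by auto
  qed
  let ?V = "{v \<in> {1..N} \<times> {s + 1..M}. T v = \<sigma>}" and ?H = "{v \<in> {r + 1..N} \<times> {1..M}. T v = \<sigma>}"
  have V: "?V \<subseteq> {u \<in> D - D0. T u = \<sigma>}" and H: "?H \<subseteq> {u \<in> D - D0. T u = \<sigma>}" by auto
  have "snd (w u) \<in> {s + 1..M}" if u: "u \<in> ?V" for u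
  proof -
    have m: "u \<in> D - D0" "T u = \<sigma>" using subsetD[OF V u] by blast+
    show ?thesis
    proof (cases "bx u = (x, y)")
      case True
      have "w u = u" using w(3)[OF m True] .
      then show ?thesis using u by (auto simp: mem_Times_iff)
    next
      case False
      have wD: "w u \<in> D - D0" by (rule subsetD[OF I(2) w(1)[OF m]])
      have "s \<le> snd u" "snd u \<in> {1..M}" using u by (auto simp: mem_Times_iff)
      then have "block q (snd u) = y" by (rule col_block(2))
      then have "block p (fst (w u)) \<noteq> x" using False w(2)[OF m] by (auto simp: box_def)
      then have "\<not> r \<le> fst (w u)" using row_block(2)[of "fst (w u)"] wD by (auto simp: mem_Times_iff)
      then show ?thesis using wD by (auto simp: mem_Times_iff)
    qed
  qed
  then have "(\<lambda>u. snd (w u)) ` ?V \<subseteq> {s + 1..M}" by blast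
  then have "card ((\<lambda>u. snd (w u)) ` ?V) \<le> card {s + 1..M}" by (intro card_mono) auto
  then show "card ?V \<le> M - s"
    using card_image[OF inj[OF independent_inj_on(3)[OF I(1) Ic] V]] by simp
  have "fst (w u) \<in> {r + 1..N}" if u: "u \<in> ?H" for u
  proof -
    have m: "u \<in> D - D0" "T u = \<sigma>" using subsetD[OF H u] by blast+
    show ?thesis
    proof (cases "bx u = (x, y)")
      case True
      have "w u = u" using w(3)[OF m True] .
      then show ?thesis using u by (auto simp: mem_Times_iff)
    next
      case False
      have wD: "w u \<in> D - D0" by (rule subsetD[OF I(2) w(1)[OF m]])
      have "r \<le> fst u" "fst u \<in> {1..N}" using u by (auto simp: mem_Times_iff)
      then have "block p (fst u) = x" by (rule row_block(2))
      then have "block q (snd (w u)) \<noteq> y" using False w(2)[OF m] by (auto simp: box_def)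
      then have "\<not> s \<le> snd (w u)" using col_block(2)[of "snd (w u)"] wD by (auto simp: mem_Times_iff)
      then show ?thesis using wD by (auto simp: mem_Times_iff)
    qed
  qed
  then have "(\<lambda>u. fst (w u)) ` ?H \<subseteq> {r + 1..N}" by blast
  then have "card ((\<lambda>u. fst (w u)) ` ?H) \<le> card {r + 1..N}" by (intro card_mono) auto
  then show "card ?H \<le> N - r"
    using card_image[OF inj[OF independent_inj_on(2)[OF I(1) Ic] H]] by simp
qed

text \<open>The columns are straightened first. This moves entries inside rows only, so the bound on
  the occurrences in the bottom rows still holds when those rows are straightened in turn.\<close>

lemma round_up_to_big_cells:
  "\<exists>L. proper_array p q N M {1..N} {1..M} L \<and> (\<forall>v\<in>D0. L v = R v)"
proof -
  obtain T where T_filled: "\<And>v. v \<in> D0 \<Longrightarrow> T v = R v"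
    and T: "proper_array p q N M {1..r} {1..s} T"
    and full: "\<And>v. v \<in> D - D0 \<Longrightarrow> \<exists>I. full_system (T v) I \<and> v \<in> I"
    using provisional_filling by metis
  note few = few_right_and_bottom[OF T_filled T full]
  have rN: "{1..r} \<subseteq> {1..N}" "{r + 1..N} \<subseteq> {1..N}" using corner_bounds(4) by auto
  have col: "block q b = y" if "b \<in> {s + 1..M}" for b using that col_block(2)[of b] by auto
  have row: "block p a = x" if "a \<in> {r + 1..N}" for a using that row_block(2)[of a] by auto
  obtain T1 where T1: "proper_array p q N M {1..r} {1..M} T1"
    and T1_eq: "\<forall>v\<in>{1..N} \<times> {1..s}. T1 v = T v"
    and T1_card: "\<forall>K\<subseteq>{1..N}. \<forall>\<sigma>.
      card {v \<in> K \<times> {1..M}. T1 v = \<sigma>} = card {v \<in> K \<times> {1..M}. T v = \<sigma>}"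
    by (rule straighten_columns[OF T rN(1) corner_bounds(6) col few(1)]) (assumption | rule that)+
  let ?T1 = "\<lambda>(b, a). T1 (a, b)"
  have card1: "card {v \<in> {1..M} \<times> {r + 1..N}. ?T1 v = \<sigma>} \<le> N - r" for \<sigma>
  proof -
    have "{v \<in> {1..M} \<times> {r + 1..N}. ?T1 v = \<sigma>} = prod.swap ` {v \<in> {r + 1..N} \<times> {1..M}. T1 v = \<sigma>}"
      by force
    then have "card {v \<in> {1..M} \<times> {r + 1..N}. ?T1 v = \<sigma>} = card {v \<in> {r + 1..N} \<times> {1..M}. T1 v = \<sigma>}"
      by (simp add: card_image)
    also have "\<dots> = card {v \<in> {r + 1..N} \<times> {1..M}. T v = \<sigma>}"
      using T1_card rN(2) by blast
    finally show ?thesis using few(2)[of \<sigma>] by simp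
  qed
  obtain T2 where T2: "proper_array q p M N {1..M} {1..N} T2"
    and T2_eq: "\<forall>v\<in>{1..M} \<times> {1..r}. T2 v = ?T1 v"
    by (rule straighten_columns[OF proper_array_transpose[OF T1] order_refl corner_bounds(4) row card1])
      (assumption | rule that)+
  have "proper_array p q N M {1..N} {1..M} (\<lambda>(a, b). T2 (b, a))"
    using proper_array_transpose[OF T2] .
  moreover have "\<forall>v\<in>D0. (\<lambda>(a, b). T2 (b, a)) v = R v"
  proof
    fix v assume v: "v \<in> D0"
    then have "v \<in> {1..N} \<times> {1..s}" "prod.swap v \<in> {1..M} \<times> {1..r}"
      using corner_bounds by auto
    from bspec[OF T1_eq this(1)] bspec[OF T2_eq this(2)] show "(\<lambda>(a, b). T2 (b, a)) v = R v"
      using T_filled[OF v] by (cases v) simp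
  qed
  ultimately show ?thesis by blast
qed

lemma completable: "can_be_completed p q (top_left r s R)"
proof -
  obtain L where L: "proper_array p q N M {1..N} {1..M} L" "\<forall>v\<in>D0. L v = R v"
    using round_up_to_big_cells by blast
  obtain L' where L': "sudoku_square p q L'" "\<forall>v\<in>D. L' v = L v"
    using complete_big_cells[OF p q _ _ L(1)] corner_bounds(1,2) by (auto simp: Suc_le_eq)
  have "L' v = \<sigma>" if "top_left r s R v = Some \<sigma>" for v \<sigma>
    using that L(2) L'(2) D_subset(1) by (auto simp: top_left_def split: if_splits)
  then show ?thesis using L'(1) unfolding can_be_completed_def by blast
qed

end

theorem theorem3:
  fixes p q r s :: nat and R :: "cell \<Rightarrow> nat"
  assumes "p \<ge> 1" and "q \<ge> 1"
    and "1 \<le> r" and "r \<le> p * q"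
    and "1 \<le> s" and "s \<le> p * q"
    and "sudoku_rectangle p q r s R"
  shows "can_be_completed p q (top_left r s R) \<longleftrightarrow> hall_condition p q (top_left r s R)"
proof
  show "hall_condition p q (top_left r s R)" if "can_be_completed p q (top_left r s R)"
    using that by (rule hall_condition_if_can_be_completed)
  show "can_be_completed p q (top_left r s R)" if "hall_condition p q (top_left r s R)"
    using assms that by (intro hall_corner.completable hall_corner.intro)
qed

end
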